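(* Fix $\varepsilon\in(0,\varepsilon_{\max})$ and write $\Omega=\Omega_\varepsilon$, $\mathbf B=\mathbf B_\varepsilon$, $w_R=w_R(\cdot;\varepsilon)$, $\lambda_R=\lambda_R(\cdot;\varepsilon)$. Let $f$ satisfy the regularity condition stated in the context. Suppose that $$(1+|w_R(t)-g(t)|)\exp\Big(-\int_t^{t_0}\lambda_R(\tau)\,d\tau\Big)\to0\quad\text{as }t\to-\infty,\qquad t_0\in\mathbb R,$$ but that the condition $$\int_{-\infty}^v f'(\tau)\exp\Big(-\int_\tau^v\lambda_R(s)\,ds\Big)d\tau>-\infty\quad\text{for all }v\in\mathbb R$$ fails. Then $\mathbf B(x;f)=+\infty$ for every $x\in\Omega\setminus\partial_{\rm fixed}\Omega$.
   Context: Domains. Let $0<\varepsilon_{\max}\le\infty$ and let $\mathbf g(\cdot;\varepsilon)=(\mathbf g_1,\mathbf g_2):\mathbb R\to\mathbb R^2$, $0\le\varepsilon<\varepsilon_{\max}$, be $C^3$ curves, $C^{3,1}$-smooth in $(t,\varepsilon)$ (the mixed derivative $\partial_t^3\partial_\varepsilon\mathbf g$ is continuous), such that for every $\varepsilon$ (primes denote $\partial_t$) $\mathbf g_1'>0$ and $\mathbf g_2''\mathbf g_1'-\mathbf g_2'\mathbf g_1''>0$. Put $g(t)=(g_1(t),g_2(t))=\mathbf g(t;0)$ and $\Xi_\varepsilon=\{(\mathbf g_1(t;\varepsilon),x_2):t\in\mathbb R,\ x_2>\mathbf g_2(t;\varepsilon)\}$. Assume that for $\varepsilon_1<\varepsilon_2$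 one has $\Xi_{\varepsilon_1}\supset\Xi_{\varepsilon_2}$ and $\mathbf g(t;\varepsilon_1)\notin\overline{\Xi_{\varepsilon_2}}$ for all $t$. Assume that for every $\varepsilon\in(0,\varepsilon_{\max})$ and $t\in\mathbb R$ there are two tangent lines from $g(t)$ to $\Xi_\varepsilon$, each meeting the curve $g(\cdot)$ twice. Let $w_L(t;\varepsilon)=\mathbf g(s_L;\varepsilon)$ and $w_R(t;\varepsilon)=\mathbf g(s_R;\varepsilon)$, $s_R<s_L$, be the tangency points, $S_L(t;\varepsilon)=[g(t),w_L(t;\varepsilon)]$, $S_R(t;\varepsilon)=[g(t),w_R(t;\varepsilon)]$ the tangent segments, and $\kappa_L,\kappa_R$ their slopes; assume $\partial_\varepsilon\kappa_L\ne0$, $\partial_\varepsilon\kappa_R\neq 0$ everywhere. Let $T_\varepsilon(t)$ be the closed curvilinear triangle with vertex $g(t)$ bounded by $S_L(t;\varepsilon)$, $S_R(t;\varepsilon)$ and the arc of $\mathbf g(\cdot;\varepsilon)$ between the two tangency points, and $\Omega_\varepsilon=\bigcup_{t}T_\varepsilon(t)$. The fixed boundary is $\partial_{\rm fixed}\Omega_\varepsilon=g(\mathbb R)$. The scalar function $\lambda_R(t;\varepsilon)>0$ is defined by $\lambda_R(t)(g(t)-w_R(t))=w_R'(t)$. Regularity condition on $f:\mathbb R\to\mathbb R$: $f\in C^2(\mathbb R)$ and $\mathfrak K=\kappa_3'/\kappa_2'$ is piecewise monotone with finitely many monotonicity intervals, where $\kappa_2=g_2'/g_1'$, $\kappa_3=f'/g_1'$.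 (Then $f'$ has constant sign near $-\infty$.) Bellman function. For an interval $I$, $\mathbf A_{\Omega_\varepsilon}(I)$ is the class of summable $\varphi:I\to\partial_{\rm fixed}\Omega_\varepsilon$ with average $\langle\varphi\rangle_J\in\Omega_\varepsilon$ for every subinterval $J\subset I$. Let $\mathrm f(g(t))=f(t)$; $\mathbf B_\varepsilon(x;f)=\sup\{\langle \mathrm f(\varphi)\rangle_I:\ \langle\varphi\rangle_I=x,\ \varphi\in\mathbf A_{\Omega_\varepsilon}(I)\}$ (independent of $I$), the supremum being over those $\varphi$ for which the average makes sense in $[-\infty,+\infty]$. *)

theory Defs
  imports "HOL-Analysis.Analysis"
begin

text \<open>
  A family of curves is a function \<open>G\<close> with \<open>G t \<epsilon>\<close> the point of parameter \<open>t\<close> on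
  the curve of index \<open>\<epsilon>\<close>. The fixed boundary curve is the one of index \<open>0\<close>.
\<close>

type_synonym curves = "real \<Rightarrow> real \<Rightarrow> real \<times> real"

text \<open>
  All derivatives \<open>\<partial>\<^sub>t\<^sup>i \<partial>\<^sub>\<epsilon>\<^sup>j G\<close> with \<open>i \<le> 3\<close> and \<open>j \<le> 1\<close> exist, in either order, and are
  jointly continuous; \<open>D i j\<close> is this derivative. The derivative in \<open>\<epsilon>\<close> is one-sided at an
  end point of \<open>E\<close>.
\<close>

definition C31_on :: "real set \<Rightarrow> curves \<Rightarrow> bool" where
  "C31_on E G \<longleftrightarrow>
    (\<exists>D :: nat \<Rightarrow> nat \<Rightarrow> curves.
      (\<forall>t. \<forall>e\<in>E. D 0 0 t e = G t e) \<and>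
      (\<forall>i<3. \<forall>j\<le>1. \<forall>t. \<forall>e\<in>E.
        ((\<lambda>\<tau>. D i j \<tau> e) has_vector_derivative D (Suc i) j t e) (at t)) \<and>
      (\<forall>i\<le>3. \<forall>t. \<forall>e\<in>E.
        ((\<lambda>\<eta>. D i 0 t \<eta>) has_vector_derivative D i 1 t e) (at e within E)) \<and>
      (\<forall>i\<le>3. \<forall>j\<le>1. continuous_on (UNIV \<times> E) (\<lambda>(t, e). D i j t e)))"

definition Xi :: "curves \<Rightarrow> real \<Rightarrow> (real \<times> real) set" where
  "Xi G \<epsilon> = {(fst (G t \<epsilon>), y) | t y. y > snd (G t \<epsilon>)}"

definition tangent_line :: "curves \<Rightarrow> real \<Rightarrow> real \<Rightarrow> (real \<times> real) set" where
  "tangent_line G \<epsilon> s =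
     range (\<lambda>r. G s \<epsilon> + r *\<^sub>R vector_derivative (\<lambda>\<tau>. G \<tau> \<epsilon>) (at s))"

definition tangency_params :: "curves \<Rightarrow> real \<Rightarrow> real \<Rightarrow> real set" where
  "tangency_params G \<epsilon> t = {s. G t 0 \<in> tangent_line G \<epsilon> s}"

text \<open>
  In the setting below \<open>tangency_params G \<epsilon> t\<close> has exactly two elements, \<open>s\<^sub>R < s\<^sub>L\<close>.
\<close>

definition w_L :: "curves \<Rightarrow> real \<Rightarrow> real \<Rightarrow> real \<times> real" where
  "w_L G \<epsilon> t = G (Max (tangency_params G \<epsilon> t)) \<epsilon>"

definition w_R :: "curves \<Rightarrow> real \<Rightarrow> real \<Rightarrow> real \<times> real" where
  "w_R G \<epsilon> t = G (Min (tangency_params G \<epsilon> t)) \<epsilon>"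

definition slope :: "real \<times> real \<Rightarrow> real \<times> real \<Rightarrow> real" where
  "slope p q = (snd q - snd p) / (fst q - fst p)"

definition kappa_L :: "curves \<Rightarrow> real \<Rightarrow> real \<Rightarrow> real" where
  "kappa_L G \<epsilon> t = slope (G t 0) (w_L G \<epsilon> t)"

definition kappa_R :: "curves \<Rightarrow> real \<Rightarrow> real \<Rightarrow> real" where
  "kappa_R G \<epsilon> t = slope (G t 0) (w_R G \<epsilon> t)"

definition index_set :: "ereal \<Rightarrow> real set" where
  "index_set \<epsilon>max = {\<epsilon>. 0 \<le> \<epsilon> \<and> ereal \<epsilon> < \<epsilon>max}"

locale curve_family =
  fixes \<epsilon>max :: ereal and G :: curves
  assumes eps_max_pos: "0 < \<epsilon>max"
    and smooth: "C31_on (index_set \<epsilon>max) G"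
    and fst_deriv_pos:
      "\<And>\<epsilon> t. \<epsilon> \<in> index_set \<epsilon>max \<Longrightarrow> deriv (\<lambda>\<tau>. fst (G \<tau> \<epsilon>)) t > 0"
    and curvature_pos:
      "\<And>\<epsilon> t. \<epsilon> \<in> index_set \<epsilon>max \<Longrightarrow>
         deriv (deriv (\<lambda>\<tau>. snd (G \<tau> \<epsilon>))) t * deriv (\<lambda>\<tau>. fst (G \<tau> \<epsilon>)) t
         - deriv (\<lambda>\<tau>. snd (G \<tau> \<epsilon>)) t * deriv (deriv (\<lambda>\<tau>. fst (G \<tau> \<epsilon>))) t > 0"
    and nested:
      "\<And>\<epsilon>1 \<epsilon>2. \<lbrakk>\<epsilon>1 \<in> index_set \<epsilon>max; \<epsilon>2 \<in> index_set \<epsilon>max; \<epsilon>1 < \<epsilon>2\<rbrakk> \<Longrightarrow> Xi G \<epsilon>2 \<subseteq> Xi G \<epsilon>1"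
    and separated:
      "\<And>\<epsilon>1 \<epsilon>2 t. \<lbrakk>\<epsilon>1 \<in> index_set \<epsilon>max; \<epsilon>2 \<in> index_set \<epsilon>max; \<epsilon>1 < \<epsilon>2\<rbrakk> \<Longrightarrow>
         G t \<epsilon>1 \<notin> closure (Xi G \<epsilon>2)"
    and two_tangents:
      "\<And>\<epsilon> t. \<lbrakk>\<epsilon> \<in> index_set \<epsilon>max; 0 < \<epsilon>\<rbrakk> \<Longrightarrow> card (tangency_params G \<epsilon> t) = 2"
    and tangents_meet_twice:
      "\<And>\<epsilon> t s. \<lbrakk>\<epsilon> \<in> index_set \<epsilon>max; 0 < \<epsilon>; s \<in> tangency_params G \<epsilon> t\<rbrakk> \<Longrightarrow>
         card (tangent_line G \<epsilon> s \<inter> range (\<lambda>\<tau>. G \<tau> 0)) = 2"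
    and kappa_L_deriv:
      "\<And>\<epsilon> t. \<lbrakk>\<epsilon> \<in> index_set \<epsilon>max; 0 < \<epsilon>\<rbrakk> \<Longrightarrow>
         \<exists>d. d \<noteq> 0 \<and> ((\<lambda>\<eta>. kappa_L G \<eta> t) has_real_derivative d) (at \<epsilon>)"
    and kappa_R_deriv:
      "\<And>\<epsilon> t. \<lbrakk>\<epsilon> \<in> index_set \<epsilon>max; 0 < \<epsilon>\<rbrakk> \<Longrightarrow>
         \<exists>d. d \<noteq> 0 \<and> ((\<lambda>\<eta>. kappa_R G \<eta> t) has_real_derivative d) (at \<epsilon>)"

text \<open>
  The arc between the two tangency points lies in the straight triangle with vertices
  \<open>g(t)\<close>, \<open>w\<^sub>R\<close>, \<open>w\<^sub>L\<close>, and the part of that triangle between the arc and the chord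
  \<open>[w\<^sub>R, w\<^sub>L]\<close> is what \<open>\<Xi>\<^sub>\<epsilon>\<close> cuts off. As \<open>\<Xi>\<^sub>\<epsilon>\<close> does not contain its boundary curve, the
  arc itself stays.
\<close>

definition curv_triangle :: "curves \<Rightarrow> real \<Rightarrow> real \<Rightarrow> (real \<times> real) set" where
  "curv_triangle G \<epsilon> t = convex hull {G t 0, w_R G \<epsilon> t, w_L G \<epsilon> t} - Xi G \<epsilon>"

definition Omega :: "curves \<Rightarrow> real \<Rightarrow> (real \<times> real) set" where
  "Omega G \<epsilon> = (\<Union>t. curv_triangle G \<epsilon> t)"

definition fixed_boundary :: "curves \<Rightarrow> (real \<times> real) set" where
  "fixed_boundary G = range (\<lambda>t. G t 0)"

definition lambda_R :: "curves \<Rightarrow> real \<Rightarrow> real \<Rightarrow> real" where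
  "lambda_R G \<epsilon> t =
     (THE l. l *\<^sub>R (G t 0 - w_R G \<epsilon> t) = vector_derivative (w_R G \<epsilon>) (at t))"

definition kappa2 :: "curves \<Rightarrow> real \<Rightarrow> real" where
  "kappa2 G t = deriv (\<lambda>\<tau>. snd (G \<tau> 0)) t / deriv (\<lambda>\<tau>. fst (G \<tau> 0)) t"

definition kappa3 :: "curves \<Rightarrow> (real \<Rightarrow> real) \<Rightarrow> real \<Rightarrow> real" where
  "kappa3 G f t = deriv f t / deriv (\<lambda>\<tau>. fst (G \<tau> 0)) t"

definition torsion :: "curves \<Rightarrow> (real \<Rightarrow> real) \<Rightarrow> real \<Rightarrow> real" where
  "torsion G f t = deriv (kappa3 G f) t / deriv (kappa2 G) t"

definition C2 :: "(real \<Rightarrow> real) \<Rightarrow> bool" where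
  "C2 f \<longleftrightarrow> (\<forall>t. f differentiable at t) \<and> (\<forall>t. deriv f differentiable at t) \<and>
     continuous_on UNIV (deriv (deriv f))"

text \<open>Monotonicity is not strict; \<open>P\<close> is the set of break points.\<close>

definition finitely_piecewise_monotone :: "(real \<Rightarrow> real) \<Rightarrow> bool" where
  "finitely_piecewise_monotone h \<longleftrightarrow>
     (\<exists>P. finite P \<and>
       (\<forall>J. is_interval J \<and> J \<inter> P = {} \<longrightarrow>
         monotone_on J (\<le>) (\<le>) h \<or> monotone_on J (\<le>) (\<ge>) h))"

definition regular :: "curves \<Rightarrow> (real \<Rightarrow> real) \<Rightarrow> bool" where
  "regular G f \<longleftrightarrow> C2 f \<and> finitely_piecewise_monotone (torsion G f)"

text \<open>
  Integral with values in \<open>[-\<infinity>, +\<infinity>]\<close>. The difference below is meaningful only under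
  \<open>has_ext_integral\<close>; otherwise it is \<open>\<infinity> - \<infinity>\<close>, which the library sets to \<open>\<infinity>\<close>.
\<close>

definition ext_integral :: "real set \<Rightarrow> (real \<Rightarrow> real) \<Rightarrow> ereal" where
  "ext_integral S h =
     enn2ereal (\<integral>\<^sup>+ s. ennreal (h s) \<partial>lebesgue_on S)
     - enn2ereal (\<integral>\<^sup>+ s. ennreal (- h s) \<partial>lebesgue_on S)"

definition has_ext_integral :: "real set \<Rightarrow> (real \<Rightarrow> real) \<Rightarrow> bool" where
  "has_ext_integral S h \<longleftrightarrow> h \<in> borel_measurable (lebesgue_on S) \<and>
     ((\<integral>\<^sup>+ s. ennreal (h s) \<partial>lebesgue_on S) < \<infinity> \<or>
      (\<integral>\<^sup>+ s. ennreal (- h s) \<partial>lebesgue_on S) < \<infinity>)"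

definition bounded_interval :: "real set \<Rightarrow> bool" where
  "bounded_interval J \<longleftrightarrow> is_interval J \<and> bounded J \<and> interior J \<noteq> {}"

definition average :: "real set \<Rightarrow> (real \<Rightarrow> real \<times> real) \<Rightarrow> real \<times> real" where
  "average J \<phi> = (1 / measure lebesgue J) *\<^sub>R (\<integral> s. \<phi> s \<partial>lebesgue_on J)"

definition ext_average :: "real set \<Rightarrow> (real \<Rightarrow> real) \<Rightarrow> ereal" where
  "ext_average J h = ext_integral J h / ereal (measure lebesgue J)"

definition test_class :: "curves \<Rightarrow> real \<Rightarrow> real set \<Rightarrow> (real \<Rightarrow> real \<times> real) set" where
  "test_class G \<epsilon> I =
     {\<phi>. integrable (lebesgue_on I) \<phi> \<and> \<phi> ` I \<subseteq> fixed_boundary G \<and>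
         (\<forall>J. bounded_interval J \<and> J \<subseteq> I \<longrightarrow> average J \<phi> \<in> Omega G \<epsilon>)}"

text \<open>
  The function on the fixed boundary determined by \<open>f\<close>. The fixed boundary curve is
  injective, since its first coordinate is increasing.
\<close>

definition boundary_fun :: "curves \<Rightarrow> (real \<Rightarrow> real) \<Rightarrow> real \<times> real \<Rightarrow> real" where
  "boundary_fun G f x = f (the_inv (\<lambda>t. G t 0) x)"

definition bellman ::
  "curves \<Rightarrow> real \<Rightarrow> real set \<Rightarrow> (real \<Rightarrow> real) \<Rightarrow> real \<times> real \<Rightarrow> ereal" where
  "bellman G \<epsilon> I f x =
     Sup {ext_average I (boundary_fun G f \<circ> \<phi>) | \<phi>.
            \<phi> \<in> test_class G \<epsilon> I \<and> average I \<phi> = x \<and>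
            has_ext_integral I (boundary_fun G f \<circ> \<phi>)}"

end

theory Submission
  imports Defs
begin

text \<open>
  One test function already has an infinite integral. Let \<open>w(t)\<close> be the contact point of the
  right tangent from \<open>g(t)\<close>. It moves along the upper boundary with \<open>w' = \<lambda> (g - w)\<close>. Let \<open>L\<close>
  be a primitive of \<open>\<lambda>\<close>, fix \<open>v\<close>, and use \<open>r = exp (L(t) - L(v))\<close>, which runs from \<open>0\<close>
  at \<open>t = -\<infinity>\<close> to \<open>1\<close> at \<open>t = v\<close>, as time. Then the differential equation reads
  \<open>d(r w)/dr = g\<close>. The decay assumption gives \<open>r w \<rightarrow> 0\<close> as \<open>r \<rightarrow> 0\<close> (\<open>contact_tendsto\<close>), so
  the function \<open>r \<mapsto> g(t(r))\<close> is integrable and its average over \<open>[0, r]\<close> is \<open>w(t(r))\<close>. It is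
  continued by the constant \<open>g(v)\<close> for \<open>r \<ge> 1\<close>; the averages over \<open>[0, r]\<close> then move along the
  right tangent segment from \<open>w(v)\<close> towards \<open>g(v)\<close>. Every point of \<open>\<Omega>\<close> off the fixed boundary
  lies on such a segment (\<open>right_tangent_through_point\<close>), so it is the average of one of
  these functions.

  This function is admissible. The set \<open>\<Omega>\<close> is the closed strip between the two curves
  (\<open>region_eq_triangles\<close>). Averages lie above the lower curve by convexity. To see that the
  average over \<open>[c, d]\<close> lies below the upper curve, let \<open>l\<close> be an affine function that vanishes on
  the right tangent current at time \<open>d\<close> and is nonnegative above it. The integral of \<open>l\<close> over
  \<open>[0, d]\<close> is zero, because the average over \<open>[0, d]\<close> lies on that tangent; the integral over \<open>[0, c]\<close>
  is nonnegative, because the upper curve is convex. Hence the integral over \<open>[c, d]\<close> is not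
  positive, and the average lies below a tangent of the upper curve (\<open>average_in_region\<close>).

  Integration by parts turns the integral of \<open>f(t(r))\<close> into boundary terms minus the integral
  of \<open>f'\<close> with the weight \<open>exp (L(t) - L(v))\<close>, which by assumption diverges to \<open>-\<infinity>\<close>. The
  regularity of \<open>f\<close> gives \<open>f'\<close> a constant sign near \<open>-\<infinity>\<close> (\<open>deriv_sign_at_bot\<close>), and divergence
  to \<open>-\<infinity>\<close> forces \<open>f' \<le> 0\<close> there. Therefore \<open>f\<close> is bounded below along the trajectory, so the integral is
  meaningful, and the boundary term \<open>r f(t(r))\<close> is bounded by the integral of \<open>f(t(r))\<close>
  itself, so it cannot compensate the divergence (\<open>weighted_primitive_bounded\<close>).
\<close>

section \<open>Convex curves\<close>

locale convex_curve =
  fixes c c' c'' :: "real \<Rightarrow> real \<times> real"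
  assumes deriv_c: "(c has_vector_derivative c' t) (at t)"
    and deriv_c': "(c' has_vector_derivative c'' t) (at t)"
    and continuous_c'': "continuous_on UNIV c''"
    and fst_c'_pos: "0 < fst (c' t)"
    and curvature_pos: "0 < snd (c'' t) * fst (c' t) - snd (c' t) * fst (c'' t)"
begin

definition grad :: "real \<Rightarrow> real" where
  "grad t = snd (c' t) / fst (c' t)"

definition grad' :: "real \<Rightarrow> real" where
  "grad' t = (snd (c'' t) * fst (c' t) - snd (c' t) * fst (c'' t)) / (fst (c' t))\<^sup>2"

text \<open>
  The height at abscissa \<open>a\<close> of the tangent at \<open>c s\<close>. Working with heights turns tangency
  into an equation in \<open>s\<close> that is monotone on each side of \<open>a\<close>.
\<close>
definition tangent_height :: "real \<Rightarrow> real \<Rightarrow> real" where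
  "tangent_height s a = snd (c s) + grad s * (a - fst (c s))"

lemma deriv_fst: "((\<lambda>t. fst (c t)) has_real_derivative fst (c' t)) (at t)"
  and deriv_snd: "((\<lambda>t. snd (c t)) has_real_derivative snd (c' t)) (at t)"
  using has_derivative_fst[OF deriv_c[of t, unfolded has_vector_derivative_def]]
    has_derivative_snd[OF deriv_c[of t, unfolded has_vector_derivative_def]]
  by (simp_all add: has_field_derivative_def mult_commute_abs)

lemma deriv_fst': "((\<lambda>t. fst (c' t)) has_real_derivative fst (c'' t)) (at t)"
  and deriv_snd': "((\<lambda>t. snd (c' t)) has_real_derivative snd (c'' t)) (at t)"
  using has_derivative_fst[OF deriv_c'[of t, unfolded has_vector_derivative_def]]
    has_derivative_snd[OF deriv_c'[of t, unfolded has_vector_derivative_def]]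
  by (simp_all add: has_field_derivative_def mult_commute_abs)

lemma fst_c'_neq_0 [simp]: "fst (c' t) \<noteq> 0"
  using fst_c'_pos[of t] by simp

lemma grad'_pos: "0 < grad' t"
  unfolding grad'_def using curvature_pos[of t] by simp

lemma deriv_grad: "(grad has_real_derivative grad' t) (at t)"
  unfolding grad_def[abs_def] grad'_def
  by (auto intro!: derivative_eq_intros deriv_fst' deriv_snd' simp: power2_eq_square)

lemma continuous_c: "isCont c t"
  using deriv_c has_vector_derivative_continuous by blast

lemma continuous_c': "isCont c' t"
  using deriv_c' has_vector_derivative_continuous by blast

lemma continuous_grad: "isCont grad t"
  using deriv_grad DERIV_isCont by blast

lemma continuous_grad': "isCont grad' t"
proof -
  have "isCont c'' t"
    using continuous_c'' by (simp add: continuous_on_eq_continuous_at)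
  then show ?thesis
    unfolding grad'_def[abs_def] using continuous_c'[of t]
    by (intro continuous_intros) auto
qed

lemma fst_less: "s < t \<Longrightarrow> fst (c s) < fst (c t)"
  by (rule DERIV_pos_imp_increasing) (use deriv_fst fst_c'_pos in auto)

lemma fst_less_iff [simp]: "fst (c s) < fst (c t) \<longleftrightarrow> s < t"
  using fst_less[of s t] fst_less[of t s] by (cases s t rule: linorder_cases) auto

lemma fst_le_iff [simp]: "fst (c s) \<le> fst (c t) \<longleftrightarrow> s \<le> t"
  by (simp flip: not_less)

lemma fst_eq_iff [simp]: "fst (c s) = fst (c t) \<longleftrightarrow> s = t"
  by (metis antisym fst_le_iff order_refl)

lemma tangent_height_self [simp]: "tangent_height s (fst (c s)) = snd (c s)"
  by (simp add: tangent_height_def)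

lemma deriv_tangent_height:
  "((\<lambda>s. tangent_height s a) has_real_derivative grad' s * (a - fst (c s))) (at s)"
  unfolding tangent_height_def
  by (rule derivative_eq_intros deriv_fst deriv_snd deriv_grad refl)+ (simp add: grad_def)

lemma continuous_tangent_height: "isCont (\<lambda>s. tangent_height s a) s"
  using deriv_tangent_height DERIV_isCont by blast

text \<open>
  The derivative in \<open>s\<close> is \<open>grad' s * (a - fst (c s))\<close>, so the height at a fixed abscissa
  increases while the tangency point approaches it from the left and decreases afterwards. This
  gives convexity, and also the uniqueness of a tangent with contact on a given side.
\<close>
lemma tangent_height_less_left:
  assumes "s < s'" "fst (c s') \<le> a"
  shows "tangent_height s a < tangent_height s' a"
proof (rule DERIV_pos_imp_increasing_open[OF assms(1)])
  fix u assume "s < u" "u < s'"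
  then have "fst (c u) < a"
    using fst_less[of u s'] assms by linarith
  then show "\<exists>y. ((\<lambda>s. tangent_height s a) has_real_derivative y) (at u) \<and> 0 < y"
    using deriv_tangent_height grad'_pos by (metis diff_gt_0_iff_gt mult_pos_pos)
qed (auto intro: continuous_at_imp_continuous_on continuous_tangent_height)

lemma tangent_height_less_right:
  assumes "s < s'" "a \<le> fst (c s)"
  shows "tangent_height s' a < tangent_height s a"
proof (rule DERIV_neg_imp_decreasing_open[OF assms(1)])
  fix u assume "s < u" "u < s'"
  then have "a < fst (c u)"
    using fst_less[of s u] assms by linarith
  then show "\<exists>y. ((\<lambda>s. tangent_height s a) has_real_derivative y) (at u) \<and> y < 0"
    using deriv_tangent_height grad'_pos by (metis diff_less_0_iff_less mult_pos_neg)
qed (auto intro: continuous_at_imp_continuous_on continuous_tangent_height)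

lemma above_tangent_strict: "s \<noteq> t \<Longrightarrow> tangent_height s (fst (c t)) < snd (c t)"
  using tangent_height_less_left[of s t "fst (c t)"] tangent_height_less_right[of t s "fst (c t)"]
  by (cases "s < t") auto

lemma above_tangent: "tangent_height s (fst (c t)) \<le> snd (c t)"
  using above_tangent_strict[of s t] by (cases "s = t") auto

text \<open>
  Otherwise the line would stay above the tangent at \<open>c t2\<close> at both outer points but not in
  between: compare its slope \<open>k\<close> with \<open>grad t2\<close>.
\<close>
lemma below_chord:
  assumes "t1 < t2" "t2 < t3"
    and "snd (c t1) \<le> m + k * fst (c t1)" "snd (c t3) \<le> m + k * fst (c t3)"
  shows "snd (c t2) < m + k * fst (c t2)"
proof -
  have *: "snd (c t2) + grad t2 * (fst (c t1) - fst (c t2)) < m + k * fst (c t1)"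
          "snd (c t2) + grad t2 * (fst (c t3) - fst (c t2)) < m + k * fst (c t3)"
    using above_tangent_strict[of t2 t1] above_tangent_strict[of t2 t3] assms
    by (auto simp: tangent_height_def)
  show ?thesis
  proof (cases "k \<le> grad t2")
    case True
    then have "k * (fst (c t3) - fst (c t2)) \<le> grad t2 * (fst (c t3) - fst (c t2))"
      using fst_less[OF assms(2)] by (intro mult_right_mono) auto
    then show ?thesis
      using *(2) by (simp add: algebra_simps)
  next
    case False
    then have "grad t2 * (fst (c t2) - fst (c t1)) \<le> k * (fst (c t2) - fst (c t1))"
      using fst_less[OF assms(1)] by (intro mult_right_mono) auto
    then show ?thesis
      using *(1) by (simp add: algebra_simps)
  qed
qed

lemma fst_in_range_between:
  assumes "fst (c s) \<le> a" "a \<le> fst (c t)"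
  obtains u where "s \<le> u" "u \<le> t" "fst (c u) = a"
proof -
  have "s \<le> t" using order_trans[OF assms] by simp
  then show ?thesis
    using IVT[of "\<lambda>u. fst (c u)" s a t] assms that continuous_c by (auto intro!: continuous_intros)
qed

lemma deriv_eqs:
  "deriv (\<lambda>t. fst (c t)) = (\<lambda>t. fst (c' t))" "deriv (\<lambda>t. snd (c t)) = (\<lambda>t. snd (c' t))"
  using deriv_fst deriv_snd by (auto intro!: ext DERIV_imp_deriv)

lemma tangent_line_eq:
  "range (\<lambda>r. c s + r *\<^sub>R vector_derivative c (at s)) = {p. tangent_height s (fst p) = snd p}"
proof -
  have "vector_derivative c (at s) = c' s"
    using deriv_c vector_derivative_at by blast
  moreover have "p = c s + ((fst p - fst (c s)) / fst (c' s)) *\<^sub>R c' s"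
    if "tangent_height s (fst p) = snd p" for p
    using that by (auto simp: tangent_height_def grad_def prod_eq_iff mult.commute)
  ultimately show ?thesis
    by (auto simp: tangent_height_def grad_def)
qed

end

section \<open>The strip between two convex curves\<close>

lemma between_as_combination:
  fixes x y a :: real
  assumes "x \<le> a" "a \<le> y" "x < y"
  obtains \<mu> where "0 \<le> \<mu>" "\<mu> \<le> 1" "a = (1 - \<mu>) * x + \<mu> * y"
proof -
  define \<mu> where "\<mu> = (a - x) / (y - x)"
  have "\<mu> * (y - x) = a - x"
    using assms by (simp add: \<mu>_def)
  then have "a = (1 - \<mu>) * x + \<mu> * y"
    by (simp add: algebra_simps)
  moreover have "0 \<le> \<mu>" "\<mu> \<le> 1"
    using assms by (auto simp: \<mu>_def)
  ultimately show thesis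
    using that by blast
qed

text \<open>
  This is what the geometry of the family gives for the fixed boundary \<open>g\<close> and one further curve
  \<open>h\<close>. The name of a tangent refers to the side of its contact point on which \<open>g t\<close> lies: the
  right tangent touches \<open>h\<close> to the left of \<open>g t\<close>.
\<close>
locale strip = lower: convex_curve g g' g'' + upper: convex_curve h h' h''
  for g g' g'' h h' h'' :: "real \<Rightarrow> real \<times> real" +
  assumes upper_over_lower: "\<exists>t. fst (g t) = fst (h s) \<and> snd (g t) < snd (h s)"
    and two_tangencies: "card {s. upper.tangent_height s (fst (g t)) = snd (g t)} = 2"
    and tangent_meets_again: "upper.tangent_height s (fst (g t)) = snd (g t) \<Longrightarrow>
      \<exists>t'. t' \<noteq> t \<and> upper.tangent_height s (fst (g t')) = snd (g t')"
begin

definition tangencies :: "real \<Rightarrow> real set" where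
  "tangencies t = {s. upper.tangent_height s (fst (g t)) = snd (g t)}"

definition right_param :: "real \<Rightarrow> real" where
  "right_param t = Min (tangencies t)"

definition left_param :: "real \<Rightarrow> real" where
  "left_param t = Max (tangencies t)"

definition region :: "(real \<times> real) set" where
  "region = {p. \<exists>t s. fst (g t) = fst p \<and> fst (h s) = fst p \<and>
    snd (g t) \<le> snd p \<and> snd p \<le> snd (h s)}"

text \<open>
  Two tangents with contact on the same side would contradict the strict monotonicity of the
  tangent height, so the two contact points lie on different sides.
\<close>
lemma tangencies_cases:
  obtains s1 s2 where "tangencies t = {s1, s2}" "s1 < s2"
    "fst (h s1) < fst (g t)" "fst (g t) < fst (h s2)"
proof -
  obtain a b where ab: "tangencies t = {a, b}" "a \<noteq> b"
    using two_tangencies[of t] unfolding tangencies_def card_2_iff by blast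
  obtain s1 s2 where s: "tangencies t = {s1, s2}" "s1 < s2"
    using ab by (cases a b rule: linorder_cases) (auto simp: insert_commute)
  have eq: "upper.tangent_height s1 (fst (g t)) = upper.tangent_height s2 (fst (g t))"
    using s(1) unfolding tangencies_def by (metis (mono_tags, lifting) insertI1 insertI2 mem_Collect_eq)
  have "fst (h s1) < fst (g t)"
    using upper.tangent_height_less_right[OF s(2), of "fst (g t)"] eq by force
  moreover have "fst (g t) < fst (h s2)"
    using upper.tangent_height_less_left[OF s(2), of "fst (g t)"] eq by force
  ultimately show thesis
    using that s by blast
qed

lemma right_param_less: "fst (h (right_param t)) < fst (g t)"
  and left_param_greater: "fst (g t) < fst (h (left_param t))"
  and right_param_mem: "right_param t \<in> tangencies t"
  and left_param_mem: "left_param t \<in> tangencies t"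
proof -
  obtain s1 s2 where "tangencies t = {s1, s2}" "s1 < s2"
    "fst (h s1) < fst (g t)" "fst (g t) < fst (h s2)"
    by (rule tangencies_cases)
  moreover from this have "right_param t = s1" "left_param t = s2"
    by (simp_all add: right_param_def left_param_def)
  ultimately show "fst (h (right_param t)) < fst (g t)" "fst (g t) < fst (h (left_param t))"
    "right_param t \<in> tangencies t" "left_param t \<in> tangencies t"
    by auto
qed

lemma right_tangent: "upper.tangent_height (right_param t) (fst (g t)) = snd (g t)"
  and left_tangent: "upper.tangent_height (left_param t) (fst (g t)) = snd (g t)"
  using right_param_mem left_param_mem by (auto simp: tangencies_def)

lemma right_param_less_left_param: "right_param t < left_param t"
  using order.strict_trans[OF right_param_less left_param_greater] by simp

lemma right_param_unique:
  assumes "fst (h s) < fst (g t)" "upper.tangent_height s (fst (g t)) = snd (g t)"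
  shows "right_param t = s"
proof (rule ccontr)
  assume "right_param t \<noteq> s"
  then consider "right_param t < s" | "s < right_param t" by linarith
  then show False
    using upper.tangent_height_less_left[of _ _ "fst (g t)"] assms right_tangent right_param_less
    by cases (metis less_imp_le less_irrefl)+
qed

lemma lower_below_upper: "\<exists>s. fst (h s) = fst (g t) \<and> snd (g t) < snd (h s)"
proof -
  obtain s where s: "fst (h s) = fst (g t)"
    using upper.fst_in_range_between[of "right_param t" "fst (g t)" "left_param t"]
      right_param_less[of t] left_param_greater[of t] by (metis less_imp_le)
  then show ?thesis
    using upper_over_lower[of s] by auto
qed

lemma below_if_same_fst: "fst (h s) = fst (g t) \<Longrightarrow> snd (g t) < snd (h s)"
  using lower_below_upper[of t] by (metis upper.fst_eq_iff)

text \<open>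
  A point of the strip lies on the vertical segment from the lower curve to the chord of the two
  contact points, hence in a triangle. Conversely the triangle lies above the tangent of the lower
  curve at the abscissa of the point.
\<close>
lemma region_eq_triangles:
  "region = (\<Union>t. convex hull {g t, h (right_param t), h (left_param t)}
      - {p. \<exists>s. fst p = fst (h s) \<and> snd (h s) < snd p})"
  (is "_ = (\<Union>t. ?hull t - ?Xi)")
proof (intro equalityI subsetI)
  fix p assume "p \<in> region"
  then obtain t s where *: "fst (g t) = fst p" "fst (h s) = fst p" "snd (g t) \<le> snd p"
    "snd p \<le> snd (h s)" unfolding region_def by blast
  define wR where "wR = h (right_param t)"
  define wL where "wL = h (left_param t)"
  have x: "fst wR < fst p" "fst p < fst wL"
    using right_param_less[of t] left_param_greater[of t] * by (auto simp: wR_def wL_def)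
  then obtain \<mu> where \<mu>: "0 \<le> \<mu>" "\<mu> \<le> 1" "fst p = (1 - \<mu>) * fst wR + \<mu> * fst wL"
    using between_as_combination[of "fst wR" "fst p" "fst wL"] by auto
  define q where "q = (1 - \<mu>) *\<^sub>R wR + \<mu> *\<^sub>R wL"
  have "snd (h s) = upper.tangent_height s (fst p)"
    using *(2) by (metis upper.tangent_height_self)
  also have "\<dots> = (1 - \<mu>) * upper.tangent_height s (fst wR) + \<mu> * upper.tangent_height s (fst wL)"
    unfolding \<mu>(3) upper.tangent_height_def by (simp add: algebra_simps)
  also have "\<dots> \<le> (1 - \<mu>) * snd wR + \<mu> * snd wL"
    using \<mu> upper.above_tangent unfolding wR_def wL_def
    by (intro add_mono mult_left_mono) auto
  finally have "snd (h s) \<le> snd q" by (simp add: q_def)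
  then have q: "snd p \<le> snd q" "fst q = fst p"
    using * \<mu> by (auto simp: q_def)
  have "p \<in> closed_segment (g t) q"
  proof -
    have "snd (g t) < snd q"
      using \<open>snd (h s) \<le> snd q\<close> below_if_same_fst[of s t] * by auto
    then obtain \<nu> where "0 \<le> \<nu>" "\<nu> \<le> 1" "snd p = (1 - \<nu>) * snd (g t) + \<nu> * snd q"
      using * q between_as_combination[of "snd (g t)" "snd p" "snd q"] by auto
    then show ?thesis
      unfolding closed_segment_def using * q
      by (auto intro!: exI[of _ \<nu>] prod_eqI simp: algebra_simps)
  qed
  moreover have "q \<in> ?hull t"
    unfolding q_def wR_def[symmetric] wL_def[symmetric] using \<mu>
    by (intro convexD[OF convex_convex_hull]) (auto intro: hull_inc)
  ultimately have "p \<in> ?hull t"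
    using closed_segment_subset[OF _ _ convex_convex_hull, of "g t" _ q]
    by (meson hull_inc insertI1 subsetD)
  moreover have "p \<notin> ?Xi"
    using * by (auto dest: sym)
  ultimately show "p \<in> (\<Union>t. ?hull t - ?Xi)" by blast
next
  fix p assume "p \<in> (\<Union>t. ?hull t - ?Xi)"
  then obtain t where t: "p \<in> ?hull t" "p \<notin> ?Xi" by blast
  then obtain a b c where abc: "0 \<le> a" "0 \<le> b" "0 \<le> c" "a + b + c = 1"
    "p = a *\<^sub>R g t + b *\<^sub>R h (right_param t) + c *\<^sub>R h (left_param t)"
    unfolding convex_hull_3 by blast
  have m: "fst (h (right_param t)) \<le> fst p" "fst p \<le> fst (h (left_param t))"
  proof -
    let ?l = "fst (h (right_param t))" and ?m = "fst (g t)" and ?r = "fst (h (left_param t))"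
    have "a * ?l + b * ?l + c * ?l \<le> a * ?m + b * ?l + c * ?r"
      using abc right_param_less[of t] left_param_greater[of t] right_param_less_left_param[of t]
      by (intro add_mono mult_left_mono) auto
    then show "?l \<le> fst p"
      using abc by (simp flip: distrib_right)
    have "a * ?m + b * ?l + c * ?r \<le> a * ?r + b * ?r + c * ?r"
      using abc right_param_less[of t] left_param_greater[of t] right_param_less_left_param[of t]
      by (intro add_mono mult_left_mono) auto
    then show "fst p \<le> ?r"
      using abc by (simp flip: distrib_right)
  qed
  obtain s where s: "fst (h s) = fst p"
    using upper.fst_in_range_between[OF m] by blast
  obtain t' where t': "fst (g t') = fst p"
    using upper_over_lower[of s] s by auto
  have above: "lower.tangent_height t' (fst (h u)) \<le> snd (h u)" for u
    using upper_over_lower[of u] lower.above_tangent[of t'] by (metis less_imp_le order_trans)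
  have "snd (g t') = lower.tangent_height t' (fst p)"
    by (metis t' lower.tangent_height_self)
  also have "\<dots> = a * lower.tangent_height t' (fst (g t)) +
      b * lower.tangent_height t' (fst (h (right_param t))) +
      c * lower.tangent_height t' (fst (h (left_param t)))"
  proof -
    have "m = a * m + b * m + c * m" for m
      using abc(4) by (simp flip: distrib_right)
    from this[of "snd (g t') - lower.grad t' * fst (g t')"] show ?thesis
      unfolding abc(5) lower.tangent_height_def by (simp add: algebra_simps)
  qed
  also have "\<dots> \<le> a * snd (g t) + b * snd (h (right_param t)) + c * snd (h (left_param t))"
    using abc above lower.above_tangent by (intro add_mono mult_left_mono) auto
  also have "\<dots> = snd p" by (simp add: abc(5))
  finally show "p \<in> region"
    unfolding region_def using s t' t(2) by (force simp: not_less)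
qed

text \<open>
  The contact point lies strictly above the lower curve, hence on the chord that the line cuts off;
  as \<open>g t\<close> is to its left, the other end is to its right.
\<close>
lemma second_intersection_beyond_left_tangency:
  obtains t' where "t < t'" "fst (h (left_param t)) < fst (g t')"
    "upper.tangent_height (left_param t) (fst (g t')) = snd (g t')"
proof -
  let ?s = "left_param t"
  obtain t' where t': "t' \<noteq> t" "upper.tangent_height ?s (fst (g t')) = snd (g t')"
    using tangent_meets_again[OF left_tangent] by blast
  obtain u where u: "fst (g u) = fst (h ?s)" "snd (g u) < snd (h ?s)"
    using upper_over_lower by blast
  then have tu: "t < u"
    using left_param_greater[of t] by (simp flip: u(1))
  have line: "upper.tangent_height ?s a = (snd (h ?s) - upper.grad ?s * fst (h ?s)) + upper.grad ?s * a" for a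
    by (simp add: upper.tangent_height_def algebra_simps)
  have on: "snd (g t) = upper.tangent_height ?s (fst (g t))"
    "snd (g u) < upper.tangent_height ?s (fst (g u))"
    using left_tangent[of t] u by auto
  have "\<not> t' < t"
    using lower.below_chord[of t' t u] tu on t' unfolding line by force
  moreover have "\<not> (t < t' \<and> t' < u)"
    using lower.below_chord[of t t' u] tu on t' unfolding line by force
  moreover have "t' \<noteq> u"
    using on t' by auto
  ultimately have "u < t'" using t'(1) by linarith
  then show thesis
    using that[of t'] t' tu u by (metis lower.fst_less order.strict_trans)
qed

text \<open>
  Let \<open>p\<close> lie above \<open>g t\<close>. By the intermediate value theorem a tangent passes through \<open>p\<close> with contact
  point \<open>h s\<close> not to the right of \<open>p\<close>. It has to be shown that this tangent meets the lower curve
  again to the right of \<open>p\<close>. The left tangent from \<open>g t\<close> does so at some \<open>g t'\<close>; as \<open>s\<close>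
  precedes its contact parameter, the tangent at \<open>s\<close> passes below \<open>g t'\<close>, and it meets the lower
  curve between \<open>g t\<close> and \<open>g t'\<close>.
\<close>
lemma right_tangent_through_point:
  assumes "p \<in> region" "p \<notin> range g"
  obtains v \<alpha> where "0 < \<alpha>" "\<alpha> \<le> 1" "p = \<alpha> *\<^sub>R h (right_param v) + (1 - \<alpha>) *\<^sub>R g v"
proof -
  obtain t s0 where p: "fst (g t) = fst p" "fst (h s0) = fst p" "snd (g t) \<le> snd p" "snd p \<le> snd (h s0)"
    using assms(1) unfolding region_def by blast
  have less: "snd (g t) < snd p"
    using assms(2) p by (metis order_le_less prod_eqI rangeI)
  obtain s where s: "s \<le> s0" "upper.tangent_height s (fst p) = snd p"
  proof -
    have "right_param t \<le> s0"
      using right_param_less[of t] p by (metis less_imp_le upper.fst_less_iff)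
    then show thesis
      using IVT[of "\<lambda>s. upper.tangent_height s (fst p)" "right_param t" "snd p" s0]
        right_tangent[of t] p less that upper.continuous_tangent_height
      by (metis less_imp_le upper.tangent_height_self)
  qed
  have s_le: "fst (h s) \<le> fst p"
    using s(1) p(2) by (metis upper.fst_le_iff)
  have s_less: "s < left_param t"
  proof -
    have "s0 < left_param t"
      using left_param_greater[of t] p by (metis upper.fst_less_iff)
    then show ?thesis using s(1) by simp
  qed
  obtain t' where t': "t < t'" "fst (h (left_param t)) < fst (g t')"
    "upper.tangent_height (left_param t) (fst (g t')) = snd (g t')"
    by (rule second_intersection_beyond_left_tangency)
  have "upper.tangent_height s (fst (g t')) < snd (g t')"
    using upper.tangent_height_less_left[OF s_less] t' by (metis less_imp_le)
  moreover have "isCont (\<lambda>v. snd (g v) - upper.tangent_height s (fst (g v))) v" for v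
    unfolding upper.tangent_height_def using lower.continuous_c by (intro continuous_intros)
  ultimately obtain v where v: "t \<le> v" "v \<le> t'" "snd (g v) - upper.tangent_height s (fst (g v)) = 0"
    using IVT[of "\<lambda>v. snd (g v) - upper.tangent_height s (fst (g v))" t 0 t'] s p less t'
    by (auto simp: less_imp_le)
  have "t \<noteq> v"
    using v s p less by auto
  then have pv: "fst p < fst (g v)"
    using v p by (metis lower.fst_less order_le_less)
  then have "right_param v = s"
    using right_param_unique[of s v] s_le v(3) by auto
  obtain \<mu> where \<mu>: "0 \<le> \<mu>" "\<mu> \<le> 1" "fst p = (1 - \<mu>) * fst (h s) + \<mu> * fst (g v)"
    using between_as_combination[of "fst (h s)" "fst p" "fst (g v)"] pv s_le by auto
  have "\<mu> \<noteq> 1"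
    using \<mu>(3) pv by auto
  have "snd p = snd (h s) + upper.grad s * (fst p - fst (h s))"
    using s(2) by (simp add: upper.tangent_height_def)
  also have "fst p - fst (h s) = \<mu> * (fst (g v) - fst (h s))"
    unfolding \<mu>(3) by (simp add: algebra_simps)
  also have "upper.grad s * (\<mu> * (fst (g v) - fst (h s))) = \<mu> * (snd (g v) - snd (h s))"
    using v(3) by (simp add: upper.tangent_height_def)
  finally have "p = (1 - \<mu>) *\<^sub>R h s + (1 - (1 - \<mu>)) *\<^sub>R g v"
    using \<mu>(3) by (auto intro!: prod_eqI simp: algebra_simps)
  then show thesis
    using that[of "1 - \<mu>" v] \<mu> \<open>\<mu> \<noteq> 1\<close> \<open>right_param v = s\<close> by auto
qed

end

section \<open>Smoothness of the right contact point\<close>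

context strip
begin

text \<open>
  The height of the tangent above \<open>g u\<close> changes sign between two parameters close to
  \<open>right_param t\<close>; this persists for \<open>u\<close> near \<open>t\<close> and traps the unique root.
\<close>
lemma continuous_right_param: "isCont right_param t"
  unfolding isCont_def
proof (rule tendstoI)
  fix e :: real assume "0 < e"
  define s where "s = right_param t"
  define F where "F = (\<lambda>s u. upper.tangent_height s (fst (g u)) - snd (g u))"
  have cont_F: "isCont (F r) u" for r u
    unfolding F_def upper.tangent_height_def using lower.continuous_c by (intro continuous_intros)
  have cont_F': "isCont (\<lambda>r. F r u) r" for r u
    unfolding F_def using upper.continuous_tangent_height by (intro continuous_intros)
  have "isCont (\<lambda>r. fst (h r)) s"
    using upper.continuous_c by (intro continuous_intros)
  then have "\<forall>\<^sub>F r in at_right s. fst (h r) < fst (g t)"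
    using right_param_less[of t]
    by (intro order_tendstoD(2)[where y="fst (h s)"])
       (auto simp: s_def isCont_def filterlim_at_split)
  moreover have "\<forall>\<^sub>F r in at_right s. r \<in> {s<..<s + e}"
    using \<open>0 < e\<close> by (intro eventually_at_right_real) auto
  ultimately have "\<forall>\<^sub>F r in at_right s. fst (h r) < fst (g t) \<and> r \<in> {s<..<s + e}"
    by eventually_elim auto
  then obtain s2 where s2: "s < s2" "s2 < s + e" "fst (h s2) < fst (g t)"
    using eventually_happens[of _ "at_right s"] by fastforce
  define s1 where "s1 = s - e / 2"
  have s1: "s1 < s" "s - e < s1"
    using \<open>0 < e\<close> by (auto simp: s1_def)
  have "F s t = 0"
    using right_tangent by (simp add: F_def s_def)
  then have F: "F s1 t < 0" "0 < F s2 t"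
    using upper.tangent_height_less_left[of s1 s "fst (g t)"] s1
      upper.tangent_height_less_left[of s s2 "fst (g t)"] s2 right_param_less[of t]
    by (auto simp: F_def s_def)
  have "\<forall>\<^sub>F u in at t. F s1 u < 0"
    using cont_F F by (intro order_tendstoD(2)) (auto simp: isCont_def)
  moreover have "\<forall>\<^sub>F u in at t. 0 < F s2 u"
    using cont_F F by (intro order_tendstoD(1)) (auto simp: isCont_def)
  moreover have "\<forall>\<^sub>F u in at t. fst (h s2) < fst (g u)"
    using s2 lower.continuous_c[of t] by (intro order_tendstoD(1)) (auto simp: isCont_def intro!: tendsto_intros)
  ultimately show "\<forall>\<^sub>F u in at t. dist (right_param u) (right_param t) < e"
  proof eventually_elim
    case (elim u)
    then obtain r where r: "s1 \<le> r" "r \<le> s2" "F r u = 0"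
      using IVT[of "\<lambda>r. F r u" s1 0 s2] cont_F' s1 s2 by (auto simp: less_imp_le)
    then have "fst (h r) < fst (g u)"
      using elim upper.fst_le_iff[of r s2] by linarith
    then have "right_param u = r"
      using right_param_unique r by (simp add: F_def)
    then show ?case
      using r s1 s2 by (auto simp: dist_real_def s_def)
  qed
qed

text \<open>The quotient given by implicit differentiation of \<open>right_tangent\<close>.\<close>
definition right_param' :: "real \<Rightarrow> real" where
  "right_param' t = (snd (g' t) - upper.grad (right_param t) * fst (g' t)) /
     (upper.grad' (right_param t) * (fst (g t) - fst (h (right_param t))))"

text \<open>
  With \<open>A u\<close> the vertical defect at \<open>g u\<close> of the tangent at \<open>s = right_param t\<close>, the mean value
  theorem in the tangency parameter gives \<open>A u = (s - right_param u) * Q u\<close>, where \<open>Q\<close> has a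
  positive limit. So the difference quotient of \<open>right_param\<close> is that of \<open>A\<close> divided by \<open>- Q\<close>.
\<close>
lemma deriv_right_param: "(right_param has_real_derivative right_param' t) (at t)"
proof -
  define s where "s = right_param t"
  define A where "A = (\<lambda>u. upper.tangent_height s (fst (g u)) - snd (g u))"
  have "(A has_real_derivative upper.grad s * fst (g' t) - snd (g' t)) (at t)"
    unfolding A_def upper.tangent_height_def
    by (rule derivative_eq_intros lower.deriv_fst lower.deriv_snd refl)+ simp
  moreover have "A t = 0"
    using right_tangent by (simp add: A_def s_def)
  ultimately have A: "((\<lambda>u. A u / (u - t)) \<longlongrightarrow> upper.grad s * fst (g' t) - snd (g' t)) (at t)"
    by (simp add: has_field_derivative_iff)
  have "\<exists>\<xi>. \<bar>\<xi> - s\<bar> \<le> \<bar>right_param u - s\<bar> \<and>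
      A u = (s - right_param u) * (upper.grad' \<xi> * (fst (g u) - fst (h \<xi>)))" for u
  proof -
    define d where "d = (\<lambda>r. upper.grad' r * (fst (g u) - fst (h r)))"
    have Au: "A u = upper.tangent_height s (fst (g u)) - upper.tangent_height (right_param u) (fst (g u))"
      by (simp add: A_def right_tangent)
    have D: "DERIV (\<lambda>r. upper.tangent_height r (fst (g u))) r :> d r" for r
      unfolding d_def by (rule upper.deriv_tangent_height)
    consider "s < right_param u" | "right_param u < s" | "right_param u = s" by linarith
    then have "\<exists>\<xi>. \<bar>\<xi> - s\<bar> \<le> \<bar>right_param u - s\<bar> \<and> A u = (s - right_param u) * d \<xi>"
    proof cases
      case 1
      then obtain z where "s < z" "z < right_param u" "upper.tangent_height (right_param u) (fst (g u))
          - upper.tangent_height s (fst (g u)) = (right_param u - s) * d z"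
        using MVT2[OF 1, of "\<lambda>r. upper.tangent_height r (fst (g u))" d] D by blast
      then show ?thesis
        by (intro exI[of _ z]) (auto simp: Au algebra_simps)
    next
      case 2
      then obtain z where "right_param u < z" "z < s" "upper.tangent_height s (fst (g u))
          - upper.tangent_height (right_param u) (fst (g u)) = (s - right_param u) * d z"
        using MVT2[OF 2, of "\<lambda>r. upper.tangent_height r (fst (g u))" d] D by blast
      then show ?thesis
        by (intro exI[of _ z]) (auto simp: Au)
    qed (auto simp: Au)
    then show ?thesis by (simp add: d_def)
  qed
  then obtain \<xi> where \<xi>: "\<And>u. \<bar>\<xi> u - s\<bar> \<le> \<bar>right_param u - s\<bar>"
      "\<And>u. A u = (s - right_param u) * (upper.grad' (\<xi> u) * (fst (g u) - fst (h (\<xi> u))))"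
    by metis
  have "((\<lambda>u. right_param u - s) \<longlongrightarrow> 0) (at t)"
    using continuous_right_param[of t] by (simp add: isCont_def s_def LIM_zero)
  then have "((\<lambda>u. \<xi> u - s) \<longlongrightarrow> 0) (at t)"
    by (rule Lim_null_comparison[rotated, OF tendsto_rabs_zero]) (use \<xi> in auto)
  then have \<xi>_lim: "(\<xi> \<longlongrightarrow> s) (at t)"
    by (simp add: LIM_zero_cancel)
  define Q where "Q = (\<lambda>u. upper.grad' (\<xi> u) * (fst (g u) - fst (h (\<xi> u))))"
  have A_eq: "A u = (s - right_param u) * Q u" for u
    by (simp add: \<xi>(2) Q_def)
  have "(Q \<longlongrightarrow> upper.grad' s * (fst (g t) - fst (h s))) (at t)"
    unfolding Q_def using lower.continuous_c[of t]
    by (intro tendsto_intros isCont_tendsto_compose[OF upper.continuous_grad' \<xi>_lim]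
        isCont_tendsto_compose[OF upper.continuous_c \<xi>_lim]) (auto simp: isCont_def)
  moreover have Q0: "upper.grad' s * (fst (g t) - fst (h s)) > 0"
    using upper.grad'_pos right_param_less[of t] by (simp add: s_def)
  ultimately have Q: "(Q \<longlongrightarrow> upper.grad' s * (fst (g t) - fst (h s))) (at t)"
    and "\<forall>\<^sub>F u in at t. Q u \<noteq> 0"
    by (auto elim: tendsto_imp_eventually_ne)
  have "((\<lambda>u. - (A u / (u - t) / Q u)) \<longlongrightarrow>
      - ((upper.grad s * fst (g' t) - snd (g' t)) / (upper.grad' s * (fst (g t) - fst (h s))))) (at t)"
    using A Q Q0 by (intro tendsto_intros) auto
  moreover have "\<forall>\<^sub>F u in at t. - (A u / (u - t) / Q u) = (right_param u - right_param t) / (u - t)"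
    using \<open>\<forall>\<^sub>F u in at t. Q u \<noteq> 0\<close>
    by eventually_elim (simp add: A_eq flip: s_def, simp only: minus_divide_left minus_diff_eq)
  ultimately have "((\<lambda>u. (right_param u - right_param t) / (u - t)) \<longlongrightarrow>
      - ((upper.grad s * fst (g' t) - snd (g' t)) / (upper.grad' s * (fst (g t) - fst (h s))))) (at t)"
    by (rule Lim_transform_eventually)
  moreover have "- ((upper.grad s * fst (g' t) - snd (g' t)) / (upper.grad' s * (fst (g t) - fst (h s))))
      = right_param' t"
    unfolding right_param'_def s_def by (simp only: minus_divide_left minus_diff_eq)
  ultimately show ?thesis
    by (simp add: has_field_derivative_iff)
qed

text \<open>
  At \<open>g t\<close> the right tangent leaves the strip downwards, so it is less steep than the lower curve.
\<close>
lemma right_param'_pos: "0 < right_param' t"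
proof -
  let ?s = "right_param t"
  obtain u where u: "fst (g u) = fst (h ?s)" "snd (g u) < snd (h ?s)"
    using upper_over_lower by blast
  have "lower.tangent_height t (fst (h ?s)) < snd (h ?s)"
    using lower.above_tangent[of t u] u by simp
  moreover have "snd (g t) = snd (h ?s) + upper.grad ?s * (fst (g t) - fst (h ?s))"
    using right_tangent[of t] by (simp add: upper.tangent_height_def)
  ultimately have "upper.grad ?s * (fst (g t) - fst (h ?s)) < lower.grad t * (fst (g t) - fst (h ?s))"
    by (simp add: lower.tangent_height_def algebra_simps)
  then have "upper.grad ?s < lower.grad t"
    using right_param_less[of t] by simp
  then have "upper.grad ?s * fst (g' t) < snd (g' t)"
    using lower.fst_c'_pos[of t] by (simp add: lower.grad_def field_simps)
  then show ?thesis
    unfolding right_param'_def using upper.grad'_pos right_param_less[of t] by simp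
qed

definition contact :: "real \<Rightarrow> real \<times> real" where
  "contact t = h (right_param t)"

definition rate :: "real \<Rightarrow> real" where
  "rate t = fst (h' (right_param t)) * right_param' t / (fst (g t) - fst (contact t))"

lemma rate_pos: "0 < rate t"
  unfolding rate_def contact_def
  using upper.fst_c'_pos right_param'_pos right_param_less[of t] by simp

text \<open>
  The contact point moves in the direction of the tangent, that is, towards \<open>g t\<close>; comparing
  first coordinates gives the factor.
\<close>
lemma deriv_contact: "(contact has_vector_derivative rate t *\<^sub>R (g t - contact t)) (at t)"
proof -
  let ?s = "right_param t"
  have "(h \<circ> right_param has_vector_derivative right_param' t *\<^sub>R h' ?s) (at t)"
    using vector_diff_chain_at deriv_right_param upper.deriv_c
    by (metis has_real_derivative_iff_has_vector_derivative)
  moreover have "right_param' t *\<^sub>R h' ?s = rate t *\<^sub>R (g t - h ?s)"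
  proof (rule prod_eqI)
    have less: "fst (h ?s) < fst (g t)"
      by (rule right_param_less)
    then show *: "fst (right_param' t *\<^sub>R h' ?s) = fst (rate t *\<^sub>R (g t - h ?s))"
      by (simp add: rate_def contact_def)
    have "snd (h' ?s) = upper.grad ?s * fst (h' ?s)"
      by (simp add: upper.grad_def)
    moreover have "snd (g t - h ?s) = upper.grad ?s * fst (g t - h ?s)"
      using right_tangent[of t] by (simp add: upper.tangent_height_def)
    ultimately show "snd (right_param' t *\<^sub>R h' ?s) = snd (rate t *\<^sub>R (g t - h ?s))"
      using * by (simp add: mult.left_commute)
  qed
  ultimately show ?thesis
    by (simp add: contact_def[abs_def] comp_def)
qed

lemma continuous_rate: "isCont rate t"
proof -
  have [continuous_intros]: "isCont (\<lambda>t. upper.grad (right_param t)) t"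
    "isCont (\<lambda>t. upper.grad' (right_param t)) t" "isCont (\<lambda>t. h (right_param t)) t"
    "isCont (\<lambda>t. h' (right_param t)) t" "isCont g t" "isCont g' t"
    using continuous_right_param upper.continuous_grad upper.continuous_grad' upper.continuous_c
      upper.continuous_c' lower.continuous_c lower.continuous_c'
    by (auto intro: isCont_o2[of _ right_param])
  have "upper.grad' (right_param t) \<noteq> 0" "fst (g t) \<noteq> fst (h (right_param t))"
    using upper.grad'_pos[of "right_param t"] right_param_less[of t] by auto
  then show ?thesis
    unfolding rate_def right_param'_def contact_def by (intro continuous_intros) auto
qed

lemma rate_unique: "l *\<^sub>R (g t - contact t) = rate t *\<^sub>R (g t - contact t) \<Longrightarrow> l = rate t"
  using right_param_less[of t] by (auto simp: contact_def prod_eq_iff)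

end

section \<open>The trajectory driven by the right tangents\<close>

text \<open>
  A primitive \<open>L\<close> of the rate replaces the integrals of the rate, which makes the exponential
  weights for different upper limits differ by constant factors only.
\<close>
locale decaying_strip = strip +
  fixes L :: "real \<Rightarrow> real"
  assumes deriv_L: "(L has_real_derivative rate t) (at t)"
    and decay: "((\<lambda>t. (1 + norm (contact t - g t)) * exp (L t)) \<longlongrightarrow> 0) at_bot"
begin

lemma L_less: "s < t \<Longrightarrow> L s < L t"
  by (rule DERIV_pos_imp_increasing) (use deriv_L rate_pos in auto)

lemma L_less_iff: "L s < L t \<longleftrightarrow> s < t"
  using L_less[of s t] L_less[of t s] by (cases s t rule: linorder_cases) auto

lemma L_eq_iff: "L s = L t \<longleftrightarrow> s = t"
  by (metis L_less_iff less_irrefl linorder_cases)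

lemma exp_L_tendsto: "((\<lambda>t. exp (L t)) \<longlongrightarrow> 0) at_bot"
  by (rule Lim_null_comparison[OF _ decay]) (auto simp: algebra_simps)

lemma gap_tendsto: "((\<lambda>t. norm (contact t - g t) * exp (L t)) \<longlongrightarrow> 0) at_bot"
  by (rule Lim_null_comparison[OF _ decay]) (auto simp: algebra_simps)

text \<open>
  The decay assumption bounds only the distance from \<open>contact t\<close> to \<open>g t\<close>. As that distance is
  \<open>o(exp (- L t))\<close>, the speed of the contact point is \<open>o(rate t * exp (- L t))\<close>, and integrating it
  bounds the contact point itself by \<open>o(exp (- L t))\<close>.
\<close>
lemma contact_tendsto: "((\<lambda>t. exp (L t) *\<^sub>R contact t) \<longlongrightarrow> 0) at_bot"
proof (rule tendstoI)
  fix e :: real assume "0 < e"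
  have "\<forall>\<^sub>F t in at_bot. norm (contact t - g t) * exp (L t) < e / 2"
    using gap_tendsto \<open>0 < e\<close> by (intro order_tendstoD(2)) auto
  then obtain t1 where t1: "\<And>t. t \<le> t1 \<Longrightarrow> norm (contact t - g t) * exp (L t) < e / 2"
    unfolding eventually_at_bot_linorder by blast
  have bound: "exp (L t) * norm (contact t) \<le> exp (L t) * norm (contact t1) + e / 2" if "t \<le> t1" for t
  proof (cases "t = t1")
    case False
    then have "t < t1" using that by simp
    \<comment> \<open>The majorant \<open>e / 2 * rate u * exp (- L u)\<close> of the speed is the derivative of
      \<open>- (e / 2 * exp (- L u))\<close>.\<close>
    have "norm (contact t1 - contact t) \<le> - (e / 2 * exp (- L t1)) - - (e / 2 * exp (- L t))"
    proof (rule differentiable_bound_general[OF \<open>t < t1\<close>])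
      show "continuous_on {t..t1} contact"
        using deriv_contact has_vector_derivative_continuous
        by (blast intro: continuous_at_imp_continuous_on)
      show "continuous_on {t..t1} (\<lambda>u. - (e / 2 * exp (- L u)))"
        using DERIV_isCont[OF deriv_L] by (intro continuous_intros continuous_at_imp_continuous_on ballI)
      fix u assume u: "t < u" "u < t1"
      show "(contact has_vector_derivative rate u *\<^sub>R (g u - contact u)) (at u)"
        by (rule deriv_contact)
      show "((\<lambda>u. - (e / 2 * exp (- L u))) has_vector_derivative e / 2 * exp (- L u) * rate u) (at u)"
        unfolding has_real_derivative_iff_has_vector_derivative[symmetric]
        by (rule derivative_eq_intros deriv_L refl)+ simp
      have "norm (contact u - g u) \<le> e / 2 * exp (- L u)"
        using t1[of u] u by (simp add: exp_minus field_simps)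
      then show "norm (rate u *\<^sub>R (g u - contact u)) \<le> e / 2 * exp (- L u) * rate u"
        using rate_pos[of u] by (simp add: norm_minus_commute mult.commute)
    qed
    also have "\<dots> \<le> e / 2 * exp (- L t)"
      using \<open>0 < e\<close> by simp
    finally have "norm (contact t) \<le> norm (contact t1) + e / 2 * exp (- L t)"
      using norm_triangle_ineq2[of "contact t" "contact t1"] by (simp add: norm_minus_commute)
    then have "exp (L t) * norm (contact t) \<le> exp (L t) * (norm (contact t1) + e / 2 * exp (- L t))"
      by (intro mult_left_mono) auto
    moreover have "exp (L t) * (e / 2 * exp (- L t)) = e / 2"
      by (simp add: exp_minus field_simps)
    ultimately show ?thesis
      by (simp only: distrib_left)
  qed (use \<open>0 < e\<close> in auto)
  have "((\<lambda>t. exp (L t) * norm (contact t1) + e / 2) \<longlongrightarrow> 0 * norm (contact t1) + e / 2) at_bot"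
    by (intro tendsto_intros exp_L_tendsto)
  then have "\<forall>\<^sub>F t in at_bot. exp (L t) * norm (contact t1) + e / 2 < e"
    using \<open>0 < e\<close> by (intro order_tendstoD(2)[where y = "e / 2"]) auto
  moreover have "\<forall>\<^sub>F t in at_bot. t \<le> t1"
    by (rule eventually_le_at_bot)
  ultimately show "\<forall>\<^sub>F t in at_bot. dist (exp (L t) *\<^sub>R contact t) 0 < e"
    by eventually_elim (use bound in fastforce)
qed

definition inv_L :: "real \<Rightarrow> real" where
  "inv_L y = (SOME t. L t = y)"

lemma inv_L_L [simp]: "inv_L (L t) = t"
  unfolding inv_L_def by (rule some_equality) (auto simp: L_eq_iff)

lemma L_inv_L:
  assumes "y \<le> L v" shows "L (inv_L y) = y"
proof -
  have "\<forall>\<^sub>F t in at_bot. exp (L t) < exp y"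
    using exp_L_tendsto by (intro order_tendstoD(2)) auto
  then have "\<forall>\<^sub>F t in at_bot. t \<le> v \<and> L t < y"
    using eventually_le_at_bot[of v] by eventually_elim simp
  then obtain u where "u \<le> v" "L u < y"
    using eventually_happens[of _ "at_bot :: real filter"] by auto
  then obtain t where "L t = y"
    using IVT[of L u y v] assms DERIV_isCont[OF deriv_L] by (auto simp: less_imp_le)
  then show ?thesis by auto
qed

lemma deriv_inv_L: "(inv_L has_real_derivative inverse (rate t)) (at (L t))"
proof (rule DERIV_inverse_function[where f = L and a = "L (t - 1)" and b = "L (t + 1)"])
  show "(L has_real_derivative rate t) (at (inv_L (L t)))"
    using deriv_L by simp
  show "isCont inv_L (L t)"
    by (rule isCont_inverse_function[where f = L and d = 1]) (auto intro: DERIV_isCont deriv_L)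
  show "rate t \<noteq> 0"
    using rate_pos[of t] by auto
  show "L (inv_L y) = y" if "y < L (t + 1)" for y
    using that L_inv_L[of y "t + 1"] by simp
qed (simp_all add: L_less)

text \<open>
  For \<open>0 < r \<le> 1\<close> this is the parameter \<open>t\<close> with \<open>exp (L t - L v) = r\<close>; from \<open>r = 1\<close> on it stays
  at \<open>v\<close>. At \<open>r = 0\<close> the value is \<open>v\<close> because \<open>ln 0 = 0\<close>, which keeps the clock below \<open>v\<close>
  on all of \<open>[0, \<infinity>)\<close>.
\<close>
definition clock :: "real \<Rightarrow> real \<Rightarrow> real" where
  "clock v r = inv_L (L v + ln (min 1 r))"

lemma L_clock: "0 < r \<Longrightarrow> L (clock v r) = L v + ln (min 1 r)"
  unfolding clock_def by (rule L_inv_L[of _ v]) simp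

lemma clock_ge_1: "1 \<le> r \<Longrightarrow> clock v r = v"
  by (simp add: clock_def)

lemma clock_le: "0 < r \<Longrightarrow> clock v r \<le> v"
proof -
  assume "0 < r"
  then have "ln (min 1 r) \<le> 0" by simp
  then have "\<not> L v < L (clock v r)"
    using L_clock[OF \<open>0 < r\<close>, of v] by linarith
  then show "clock v r \<le> v"
    using L_less_iff[of v "clock v r"] by simp
qed

lemma clock_mono: "0 < r \<Longrightarrow> r \<le> r' \<Longrightarrow> clock v r \<le> clock v r'"
proof -
  assume "0 < r" "r \<le> r'"
  then have "ln (min 1 r) \<le> ln (min 1 r')" by simp
  then have "L (clock v r) \<le> L (clock v r')"
    using L_clock[of r v] L_clock[of r' v] \<open>0 < r\<close> \<open>r \<le> r'\<close> by simp
  then show "clock v r \<le> clock v r'"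
    using L_less_iff[of "clock v r'" "clock v r"] by linarith
qed

lemma exp_L_clock: "0 < r \<Longrightarrow> exp (L (clock v r)) = exp (L v) * min 1 r"
  by (simp add: L_clock exp_add)

lemma deriv_clock:
  assumes "0 < r" "r < 1"
  shows "(clock v has_real_derivative inverse (rate (clock v r)) / r) (at r)"
proof -
  have eq: "L v + ln r = L (clock v r)"
    using L_clock[of r v] assms by simp
  have "((\<lambda>r. inv_L (L v + ln r)) has_real_derivative inverse (rate (clock v r)) * (1 / r)) (at r)"
  proof (rule DERIV_chain2[where f = inv_L])
    show "(inv_L has_real_derivative inverse (rate (clock v r))) (at (L v + ln r))"
      unfolding eq by (rule deriv_inv_L)
    show "((\<lambda>r. L v + ln r) has_real_derivative 1 / r) (at r)"
      using assms by (auto intro!: derivative_eq_intros)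
  qed
  then have "(clock v has_real_derivative inverse (rate (clock v r)) * (1 / r)) (at r)"
    by (rule has_field_derivative_transform_within_open[where S = "{..<1}"])
      (use assms in \<open>auto simp: clock_def\<close>)
  then show ?thesis by simp
qed

lemma continuous_clock: "0 < r \<Longrightarrow> isCont (clock v) r"
proof -
  assume "0 < r"
  have "isCont (\<lambda>r. L v + ln (min 1 r)) r"
    using \<open>0 < r\<close> by (intro continuous_intros) auto
  moreover have "isCont inv_L (L v + ln (min 1 r))"
    using DERIV_isCont[OF deriv_inv_L[of "clock v r"]] by (simp only: L_clock[OF \<open>0 < r\<close>])
  ultimately show ?thesis
    unfolding clock_def by (rule isCont_o2)
qed

lemma clock_at_bot: "filterlim (clock v) at_bot (at_right 0)"
  unfolding filterlim_at_bot
proof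
  fix Z
  have "\<forall>\<^sub>F r in at_right 0. r \<in> {0<..<min 1 (exp (L Z - L v))}"
    by (intro eventually_at_right_real) auto
  then show "\<forall>\<^sub>F r in at_right 0. clock v r \<le> Z"
  proof eventually_elim
    case (elim r)
    then have r: "0 < r" "r < 1" "r < exp (L Z - L v)" by auto
    then have "ln r < ln (exp (L Z - L v))"
      by (subst ln_less_cancel_iff) auto
    then have "L v + ln r < L Z" by simp
    moreover have "L (clock v r) = L v + ln r"
      using L_clock[OF r(1), of v] r(2) by (simp add: min_def)
    ultimately have "clock v r < Z"
      using L_less_iff[of "clock v r" Z] by simp
    then show ?case by simp
  qed
qed

definition trajectory :: "real \<Rightarrow> real \<Rightarrow> real \<times> real" where
  "trajectory v r = g (clock v r)"

text \<open>
  The integral of the trajectory over \<open>[0, r]\<close> in closed form: the average is a contact point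
  up to time \<open>1\<close>, and a constant stretch follows.
\<close>
definition total :: "real \<Rightarrow> real \<Rightarrow> real \<times> real" where
  "total v r = min 1 r *\<^sub>R contact (clock v r) + max 0 (r - 1) *\<^sub>R g v"

text \<open>
  For \<open>r < 1\<close> the clock has derivative \<open>1 / (r * rate)\<close>, so the contact point moves with velocity
  \<open>(g - contact) / r\<close> and \<open>r * contact\<close> has derivative \<open>g\<close>.
\<close>
lemma deriv_total:
  assumes "0 < r" "r \<noteq> 1"
  shows "(total v has_vector_derivative trajectory v r) (at r)"
proof (cases "r < 1")
  case True
  define t where "t = clock v r"
  have "(clock v has_vector_derivative inverse (rate t) / r) (at r)"
    using deriv_clock[OF assms(1) True]
    unfolding t_def has_real_derivative_iff_has_vector_derivative .
  then have "(contact \<circ> clock v has_vector_derivative (inverse (rate t) / r) *\<^sub>R (rate t *\<^sub>R (g t - contact t))) (at r)"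
    unfolding t_def by (rule vector_diff_chain_at[OF _ deriv_contact])
  then have "((\<lambda>r. r *\<^sub>R contact (clock v r)) has_vector_derivative
      r *\<^sub>R ((inverse (rate t) / r) *\<^sub>R (rate t *\<^sub>R (g t - contact t))) + 1 *\<^sub>R contact t) (at r)"
    unfolding t_def by (intro has_vector_derivative_scaleR) (auto simp: comp_def)
  also have "r *\<^sub>R ((inverse (rate t) / r) *\<^sub>R (rate t *\<^sub>R (g t - contact t))) + 1 *\<^sub>R contact t = trajectory v r"
    using rate_pos[of t] assms by (simp add: trajectory_def t_def)
  finally show ?thesis
    by (rule has_vector_derivative_transform_within_open[where S = "{..<1}"])
      (use True in \<open>auto simp: total_def\<close>)
next
  case False
  then have "1 < r" using assms by simp
  have "((\<lambda>r. contact v + (r - 1) *\<^sub>R g v) has_vector_derivative trajectory v r) (at r)"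
    using \<open>1 < r\<close> by (auto intro!: derivative_eq_intros simp: trajectory_def clock_ge_1)
  then show ?thesis
    by (rule has_vector_derivative_transform_within_open[where S = "{1<..}"])
      (use \<open>1 < r\<close> in \<open>auto simp: total_def clock_ge_1\<close>)
qed

lemma total_0 [simp]: "total v 0 = 0"
  by (simp add: total_def)

lemma continuous_contact: "isCont contact t"
  using deriv_contact has_vector_derivative_continuous by blast

lemma continuous_total: "continuous_on {0..} (total v)"
  unfolding continuous_on_eq_continuous_within
proof
  fix r :: real assume "r \<in> {0..}"
  then consider "r = 0" | "0 < r" by force
  then show "continuous (at r within {0..}) (total v)"
  proof cases
    case 1
    have "((\<lambda>r. exp (- L v) *\<^sub>R (exp (L (clock v r)) *\<^sub>R contact (clock v r))) \<longlongrightarrow> exp (- L v) *\<^sub>R 0) (at_right 0)"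
      by (intro tendsto_intros filterlim_compose[OF contact_tendsto clock_at_bot])
    moreover have "\<forall>\<^sub>F r in at_right 0. exp (- L v) *\<^sub>R (exp (L (clock v r)) *\<^sub>R contact (clock v r)) = total v r"
      using eventually_at_right_real[OF zero_less_one]
      by eventually_elim (auto simp: total_def exp_L_clock exp_minus)
    ultimately have "(total v \<longlongrightarrow> 0) (at_right 0)"
      by (auto elim: Lim_transform_eventually)
    moreover have "at 0 within {0..} = at_right (0::real)"
      by (rule at_within_nhd[of _ UNIV]) auto
    ultimately show ?thesis
      using 1 by (simp add: continuous_within)
  next
    case 2
    have "isCont (\<lambda>r. contact (clock v r)) r"
      by (rule isCont_o2[OF continuous_clock[OF 2] continuous_contact])
    then have "isCont (total v) r"
      unfolding total_def by (intro continuous_intros)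
    then show ?thesis
      by (rule continuous_at_imp_continuous_at_within)
  qed
qed

lemma clock_le': "0 \<le> r \<Longrightarrow> clock v r \<le> v"
  by (cases "r = 0") (auto simp: clock_le, simp add: clock_def)

lemma trajectory_has_integral:
  assumes "0 \<le> c" "c \<le> d"
  shows "(trajectory v has_integral total v d - total v c) {c..d}"
proof (rule fundamental_theorem_of_calculus_interior_strong[where S = "{1}"])
  show "continuous_on {c..d} (total v)"
    using assms by (intro continuous_on_subset[OF continuous_total]) auto
qed (use assms deriv_total in auto)

lemma trajectory_component_integrals:
  assumes "0 \<le> c" "c \<le> d"
  shows fst_trajectory_has_integral:
      "((\<lambda>r. fst (trajectory v r)) has_integral fst (total v d - total v c)) {c..d}"
    and snd_trajectory_has_integral:
      "((\<lambda>r. snd (trajectory v r)) has_integral snd (total v d - total v c)) {c..d}"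
  using has_integral_linear[OF trajectory_has_integral[OF assms] bounded_linear_fst]
    has_integral_linear[OF trajectory_has_integral[OF assms] bounded_linear_snd]
  by (simp_all add: comp_def)

lemma trajectory_on_curve: "trajectory v r \<in> range g"
  by (simp add: trajectory_def)

text \<open>
  Two linear functions of the trajectory have a sign: the first coordinate stays below that of
  \<open>g v\<close>, and the trajectory stays above the tangent of the lower curve at \<open>g v\<close>. For functions
  with a sign, integrability is absolute.
\<close>
lemma trajectory_absolutely_integrable:
  assumes "0 \<le> d"
  shows "trajectory v absolutely_integrable_on {0..d}"
proof -
  note int = fst_trajectory_has_integral[OF order.refl assms] snd_trajectory_has_integral[OF order.refl assms]
  have "(\<lambda>r. fst (g v) - fst (trajectory v r)) absolutely_integrable_on {0..d}"
    using int(1) clock_le'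
    by (intro nonnegative_absolutely_integrable_1 integrable_diff) (auto simp: trajectory_def)
  then have "(\<lambda>r. fst (g v) - (fst (g v) - fst (trajectory v r))) absolutely_integrable_on {0..d}"
    by (rule set_integral_diff(1)[rotated]) auto
  then have 1: "(\<lambda>r. fst (trajectory v r)) absolutely_integrable_on {0..d}"
    by simp
  have tangent: "(\<lambda>r. lower.tangent_height v (fst (trajectory v r))) absolutely_integrable_on {0..d}"
    unfolding lower.tangent_height_def using 1
    by (intro set_integral_add set_integral_mult_right set_integral_diff) auto
  have "(\<lambda>r. snd (trajectory v r) - lower.tangent_height v (fst (trajectory v r))) integrable_on {0..d}"
    using int(2) set_lebesgue_integral_eq_integral(1)[OF tangent]
    by (intro integrable_diff) auto
  then have "(\<lambda>r. snd (trajectory v r) - lower.tangent_height v (fst (trajectory v r))) absolutely_integrable_on {0..d}"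
    using lower.above_tangent
    by (intro nonnegative_absolutely_integrable_1) (auto simp: trajectory_def)
  from set_integral_add(1)[OF this tangent]
  have "(\<lambda>r. snd (trajectory v r)) absolutely_integrable_on {0..d}"
    by simp
  then show ?thesis
    using 1 by (subst absolutely_integrable_componentwise_iff) (auto simp: Basis_prod_def inner_prod_def)
qed

text \<open>
  Here \<open>l p r\<close> is \<open>r\<close> times the height of the point \<open>p / r\<close> above the tangent at \<open>h s\<close>. So \<open>l\<close>
  compares averages over \<open>[0, r]\<close> with the right tangent current at time \<open>d\<close>. After time \<open>1\<close> both
  \<open>contact v\<close> and \<open>g v\<close> lie on that tangent, which is why the constant stretch contributes
  nothing.
\<close>
lemma total_on_or_above_tangent:
  fixes v c d :: real
  assumes "0 < d" "0 \<le> c" "c \<le> d"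
  defines "s \<equiv> right_param (clock v d)"
  defines "l \<equiv> (\<lambda>p r. snd p - upper.grad s * fst p - r * (snd (h s) - upper.grad s * fst (h s)))"
  shows "l (total v d) d = 0" "0 \<le> l (total v c) c"
proof -
  have l_total: "l (total v r) r = min 1 r * (snd (contact (clock v r)) - upper.tangent_height s (fst (contact (clock v r))))
     + max 0 (r - 1) * (snd (g v) - upper.tangent_height s (fst (g v)))" for r
  proof -
    have "r * k = min 1 r * k + max 0 (r - 1) * k" for k
      by (cases "r \<le> 1") (auto simp: algebra_simps)
    from this[of "snd (h s) - upper.grad s * fst (h s)"] show ?thesis
      unfolding l_def by (simp add: total_def upper.tangent_height_def algebra_simps)
  qed
  have g_v: "max 0 (r - 1) * (snd (g v) - upper.tangent_height s (fst (g v))) = 0" if "r \<le> d" for r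
    using that right_tangent[of v] by (cases "1 < r") (auto simp: s_def clock_ge_1)
  show "l (total v d) d = 0"
    unfolding l_total g_v[OF order.refl] by (simp add: contact_def s_def)
  show "0 \<le> l (total v c) c"
    unfolding l_total g_v[OF \<open>c \<le> d\<close>] using upper.above_tangent assms(2) by (simp add: contact_def)
qed

text \<open>
  The hypothesis says that \<open>q\<close> is the average over \<open>[c, d]\<close>. The lower bound is Jensen's
  inequality with the tangent of the lower curve at the abscissa of \<open>q\<close>, so that abscissa has to be
  reached by the curve. For \<open>c > 0\<close> this holds since the trajectory starts at
  \<open>g (clock v c)\<close>; for \<open>c = 0\<close> it may be unbounded, but \<open>q\<close> lies on a right tangent segment.
  The upper bound is the tangent at the contact point of time \<open>d\<close>.
\<close>
lemma average_in_region:
  fixes v c d :: real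
  assumes "0 \<le> c" "c < d" and total_diff: "total v d - total v c = (d - c) *\<^sub>R q"
  shows "q \<in> region"
proof -
  have fst_int: "((\<lambda>r. fst (trajectory v r)) has_integral (d - c) * fst q) {c..d}"
    and snd_int: "((\<lambda>r. snd (trajectory v r)) has_integral (d - c) * snd q) {c..d}"
    using trajectory_component_integrals[of c d v] assms unfolding total_diff by simp_all
  have const: "((\<lambda>_. k) has_integral (d - c) * k) {c..d}" for k :: real
    using has_integral_const_real[of k c d] assms by simp
  have "fst q \<le> fst (g v)"
  proof -
    have "(d - c) * fst q \<le> (d - c) * fst (g v)"
      using clock_le' assms by (intro has_integral_le[OF fst_int const]) (auto simp: trajectory_def)
    then show ?thesis using assms by simp
  qed
  moreover obtain t0 where "fst (g t0) \<le> fst q"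
  proof (cases "c = 0")
    case False
    then have "0 < c" using assms by simp
    have "(d - c) * fst (g (clock v c)) \<le> (d - c) * fst q"
      using \<open>0 < c\<close> clock_mono by (intro has_integral_le[OF const fst_int]) (auto simp: trajectory_def)
    then show thesis using assms that by simp
  next
    case True
    let ?s = "right_param (clock v d)"
    have "fst (h ?s) < fst (g (clock v d))"
      by (rule right_param_less)
    also have "\<dots> \<le> fst (g v)"
      using clock_le[of d v] assms by simp
    finally have "max 0 (d - 1) * fst (h ?s) \<le> max 0 (d - 1) * fst (g v)"
      by (intro mult_left_mono) auto
    then have "(min 1 d + max 0 (d - 1)) * fst (h ?s) \<le> fst (total v d)"
      by (simp add: total_def contact_def distrib_right)
    moreover have "min 1 d + max 0 (d - 1) = d" by auto
    moreover have "total v d = d *\<^sub>R q"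
      using total_diff True by simp
    ultimately have "d * fst (h ?s) \<le> d * fst q"
      by simp
    then have "fst (h ?s) \<le> fst q" using assms by simp
    moreover obtain t0 where "fst (g t0) = fst (h ?s)"
      using upper_over_lower by blast
    ultimately show thesis
      using that[of t0] by simp
  qed
  ultimately obtain t where t: "fst (g t) = fst q"
    using lower.fst_in_range_between[of t0 "fst q" v] by blast
  obtain u where u: "fst (h u) = fst q"
    using lower_below_upper[of t] t by auto
  have "snd (g t) \<le> snd q"
  proof -
    have "((\<lambda>r. (snd (g t) - lower.grad t * fst (g t)) + lower.grad t * fst (trajectory v r)) has_integral
        (d - c) * (snd (g t) - lower.grad t * fst (g t)) + lower.grad t * ((d - c) * fst q)) {c..d}"
      by (intro has_integral_add const has_integral_mult_right fst_int)
    moreover have "(snd (g t) - lower.grad t * fst (g t)) + lower.grad t * fst (trajectory v r) \<le> snd (trajectory v r)" for r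
      using lower.above_tangent[of t "clock v r"]
      by (simp add: trajectory_def lower.tangent_height_def algebra_simps)
    ultimately have "(d - c) * (snd (g t) - lower.grad t * fst (g t)) + lower.grad t * ((d - c) * fst q)
        \<le> (d - c) * snd q"
      by (rule has_integral_le[OF _ snd_int])
    then have "(d - c) * snd (g t) \<le> (d - c) * snd q"
      by (simp add: t algebra_simps)
    then show ?thesis using assms by simp
  qed
  moreover have "snd q \<le> snd (h u)"
  proof -
    let ?s = "right_param (clock v d)"
    note l = total_on_or_above_tangent[of d c v]
    have "snd (total v d - total v c) - upper.grad ?s * fst (total v d - total v c)
        - (d - c) * (snd (h ?s) - upper.grad ?s * fst (h ?s)) \<le> 0"
      using l assms by (simp add: algebra_simps)
    then have "(d - c) * snd q \<le> (d - c) * upper.tangent_height ?s (fst q)"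
      unfolding total_diff upper.tangent_height_def by (simp add: algebra_simps)
    then have "snd q \<le> upper.tangent_height ?s (fst q)"
      using assms by simp
    also have "\<dots> \<le> snd (h u)"
      using upper.above_tangent[of ?s u] u by simp
    finally show ?thesis .
  qed
  ultimately show ?thesis
    unfolding region_def using t u by blast
qed

end

section \<open>Averages over intervals\<close>

text \<open>
  Intervals of all kinds (open, closed, half-open) are handled as sets between an open interval
  and its closure, from which they differ by a null set.
\<close>
lemma bounded_interval_endpoints:
  assumes "bounded_interval J"
  obtains c d where "c < d" "{c<..<d} \<subseteq> J" "J \<subseteq> {c..d}"
proof -
  have J: "is_interval J" "bounded J" "interior J \<noteq> {}"
    using assms by (auto simp: bounded_interval_def)
  obtain x e where "0 < e" "ball x e \<subseteq> J"
    using J(3) by (auto simp: mem_interior)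
  then have mem: "x \<in> J" "x + e / 2 \<in> J"
    by (auto simp: ball_def dist_real_def subset_iff)
  have bdd: "bdd_below J" "bdd_above J"
    using J(2) by (auto intro: bounded_imp_bdd_below bounded_imp_bdd_above)
  have "{Inf J<..<Sup J} \<subseteq> J"
  proof
    fix y assume "y \<in> {Inf J<..<Sup J}"
    then obtain a b where "a \<in> J" "a < y" "b \<in> J" "y < b"
      using cInf_less_iff[of J y] less_cSup_iff[of J y] mem(1) bdd by auto
    then show "y \<in> J"
      using J(1) unfolding is_interval_1 by (meson less_imp_le)
  qed
  moreover have "J \<subseteq> {Inf J..Sup J}"
    using bdd by (auto intro: cInf_lower cSup_upper)
  moreover have "Inf J < Sup J"
    using cInf_lower[OF mem(1) bdd(1)] cSup_upper[OF mem(2) bdd(2)] \<open>0 < e\<close> by linarith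
  ultimately show thesis using that by blast
qed

lemma between_open_and_closed:
  fixes c d :: real and f :: "real \<Rightarrow> 'a::banach"
  assumes "c < d" "{c<..<d} \<subseteq> J" "J \<subseteq> {c..d}"
  shows "J \<in> sets lebesgue" "emeasure lebesgue J = ennreal (d - c)" "measure lebesgue J = d - c"
    and "(f has_integral y) J \<longleftrightarrow> (f has_integral y) {c..d}"
proof -
  have "J = {c<..<d} \<union> (J \<inter> {c, d})"
    using assms by force
  moreover have "J \<inter> {c, d} \<in> sets lebesgue"
    by (intro negligible_imp_sets negligible_finite) auto
  moreover have "{c<..<d} \<in> sets lebesgue" by simp
  ultimately show J: "J \<in> sets lebesgue"
    by (metis sets.Un)
  have "emeasure lebesgue {c<..<d} \<le> emeasure lebesgue J" "emeasure lebesgue J \<le> emeasure lebesgue {c..d}"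
    using assms J by (intro emeasure_mono; simp)+
  moreover have "emeasure lebesgue {c<..<d} = ennreal (d - c)" "emeasure lebesgue {c..d} = ennreal (d - c)"
    using assms by simp_all
  ultimately show "emeasure lebesgue J = ennreal (d - c)"
    using assms by simp
  then show "measure lebesgue J = d - c"
    using assms by (simp add: measure_def)
  show "(f has_integral y) J \<longleftrightarrow> (f has_integral y) {c..d}"
  proof (rule has_integral_spike_set_eq)
    show "negligible {x \<in> J - {c..d}. f x \<noteq> 0}"
      by (rule negligible_subset[OF negligible_empty]) (use assms in auto)
    show "negligible {x \<in> {c..d} - J. f x \<noteq> 0}"
      by (rule negligible_subset[of "{c, d}"]) (use assms in force)+
  qed
qed

lemma average_eq:
  fixes \<psi> :: "real \<Rightarrow> real \<times> real"
  assumes "c < d" "{c<..<d} \<subseteq> J" "J \<subseteq> {c..d}"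
    and "\<psi> absolutely_integrable_on {c..d}" "(\<psi> has_integral y) {c..d}"
  shows "average J \<psi> = (1 / (d - c)) *\<^sub>R y"
proof -
  note J = between_open_and_closed[OF assms(1-3)]
  have "\<psi> absolutely_integrable_on J"
    using assms J by (auto intro: set_integrable_subset)
  then have "integral\<^sup>L (lebesgue_on J) \<psi> = integral J \<psi>"
    by (intro lebesgue_integral_eq_integral absolutely_integrable_imp_integrable J)
  also have "\<dots> = y"
    using assms(5) by (intro integral_unique) (simp add: J)
  finally show ?thesis
    by (simp add: average_def J)
qed

lemma rescale_has_integral:
  fixes f :: "real \<Rightarrow> 'a::real_normed_vector"
  assumes "0 < p" "(f has_integral y) {(c - a) / p..(d - a) / p}"
  shows "((\<lambda>u. f ((u - a) / p)) has_integral p *\<^sub>R y) {c..d}"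
proof -
  have "((\<lambda>u. f ((1 / p) *\<^sub>R u + - a / p)) has_integral (y /\<^sub>R (1 / p) ^ DIM(real)))
      (cbox (((c - a) / p - - a / p) /\<^sub>R (1 / p)) (((d - a) / p - - a / p) /\<^sub>R (1 / p)))"
    using assms by (intro has_integral_affinity') (auto simp: cbox_interval)
  moreover have "(1 / p) *\<^sub>R u + - a / p = (u - a) / p" for u
    by (simp add: diff_divide_distrib)
  moreover have "((e - a) / p - - a / p) /\<^sub>R (1 / p) = e" for e
    using assms(1) by (simp add: field_simps)
  ultimately show ?thesis
    using assms(1) by (simp add: cbox_interval)
qed

context decaying_strip
begin

context
  fixes a b p v :: real and I :: "real set"
  assumes I: "a < b" "{a<..<b} \<subseteq> I" "I \<subseteq> {a..b}" and p: "0 < p"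
begin

lemma rescaled_trajectory_has_integral:
  assumes "a \<le> c" "c \<le> d"
  shows "((\<lambda>u. trajectory v ((u - a) / p)) has_integral
      p *\<^sub>R (total v ((d - a) / p) - total v ((c - a) / p))) {c..d}"
  using assms p by (intro rescale_has_integral trajectory_has_integral) (auto intro: divide_right_mono)

lemma rescaled_trajectory_absolutely_integrable:
  assumes "a \<le> c" "c \<le> d"
  shows "(\<lambda>u. trajectory v ((u - a) / p)) absolutely_integrable_on {c..d}"
proof -
  have "0 \<le> (d - a) / p"
    using assms p by simp
  then have "(\<lambda>r. norm (trajectory v r)) integrable_on {0..(d - a) / p}"
    using trajectory_absolutely_integrable absolutely_integrable_on_def by blast
  then have "(\<lambda>r. norm (trajectory v r)) integrable_on {(c - a) / p..(d - a) / p}"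
    by (rule integrable_on_subinterval) (use assms p in auto)
  then have "(\<lambda>u. norm (trajectory v ((u - a) / p))) integrable_on {c..d}"
    using rescale_has_integral[OF p, of "\<lambda>r. norm (trajectory v r)"] by blast
  then show ?thesis
    using rescaled_trajectory_has_integral[OF assms] unfolding absolutely_integrable_on_def by blast
qed

lemma rescaled_trajectory_integrable: "integrable (lebesgue_on I) (\<lambda>u. trajectory v ((u - a) / p))"
  using between_open_and_closed(1)[OF I] rescaled_trajectory_absolutely_integrable[of a b] I
  by (auto intro!: absolutely_integrable_imp_integrable intro: set_integrable_subset)

lemma average_rescaled_trajectory:
  assumes J: "c < d" "{c<..<d} \<subseteq> J" "J \<subseteq> {c..d}" and "J \<subseteq> I"
  shows "a \<le> c" "average J (\<lambda>u. trajectory v ((u - a) / p)) =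
    (p / (d - c)) *\<^sub>R (total v ((d - a) / p) - total v ((c - a) / p))"
proof -
  have "{c<..<d} \<subseteq> {a..b}"
    using J I \<open>J \<subseteq> I\<close> by blast
  then have "{c..d} \<subseteq> {a..b}"
    using closure_mono[of "{c<..<d}" "{a..b}"] J(1) by simp
  then show "a \<le> c"
    using J(1) by simp
  then show "average J (\<lambda>u. trajectory v ((u - a) / p)) =
    (p / (d - c)) *\<^sub>R (total v ((d - a) / p) - total v ((c - a) / p))"
    using J(1)
    by (subst average_eq[OF J rescaled_trajectory_absolutely_integrable rescaled_trajectory_has_integral]) auto
qed

lemma average_rescaled_trajectory_in_region:
  assumes "bounded_interval J" "J \<subseteq> I"
  shows "average J (\<lambda>u. trajectory v ((u - a) / p)) \<in> region"
proof -
  obtain c d where J: "c < d" "{c<..<d} \<subseteq> J" "J \<subseteq> {c..d}"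
    using bounded_interval_endpoints[OF assms(1)] .
  note avg = average_rescaled_trajectory[OF J assms(2)]
  show ?thesis
  proof (rule average_in_region)
    show "0 \<le> (c - a) / p" "(c - a) / p < (d - a) / p"
      using p J avg(1) by (auto intro: divide_strict_right_mono)
    have "((d - a) / p - (c - a) / p) * (p / (d - c)) = 1"
      using p J(1) by (simp flip: diff_divide_distrib)
    then show "total v ((d - a) / p) - total v ((c - a) / p) =
        ((d - a) / p - (c - a) / p) *\<^sub>R average J (\<lambda>u. trajectory v ((u - a) / p))"
      unfolding avg(2) by simp
  qed
qed

lemma average_rescaled_trajectory_total:
  assumes "p \<le> b - a"
  defines "\<alpha> \<equiv> p / (b - a)"
  shows "average I (\<lambda>u. trajectory v ((u - a) / p)) = \<alpha> *\<^sub>R contact v + (1 - \<alpha>) *\<^sub>R g v"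
proof -
  have "1 \<le> (b - a) / p"
    using assms p by simp
  then have "total v ((b - a) / p) = contact v + ((b - a) / p - 1) *\<^sub>R g v"
    by (simp add: total_def clock_ge_1)
  moreover have "\<alpha> * ((b - a) / p) = 1"
    using p I(1) by (simp add: \<alpha>_def)
  then have "\<alpha> * ((b - a) / p - 1) = 1 - \<alpha>"
    by (simp only: right_diff_distrib mult_1_right)
  ultimately show ?thesis
    unfolding average_rescaled_trajectory(2)[OF I order.refl] by (simp add: scaleR_add_right flip: \<alpha>_def)
qed

end
end

section \<open>Divergence of the integral of the boundary function\<close>

text \<open>Monotone convergence along the intervals \<open>[b - n, b]\<close>.\<close>
lemma nn_integral_lower_ray_bounded:
  fixes f F :: "real \<Rightarrow> real"
  assumes f: "\<And>t. isCont f t" and F: "\<And>t. (F has_real_derivative - f t) (at t)"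
    and nonneg: "\<And>t. t \<le> b \<Longrightarrow> 0 \<le> f t" and bound: "\<And>t. t \<le> b \<Longrightarrow> F t \<le> B"
  shows "(\<integral>\<^sup>+ t. ennreal (f t) * indicator {..b} t \<partial>lborel) \<le> ennreal (B - F b)"
proof -
  let ?f = "\<lambda>n t. ennreal (f t) * indicator {b - real n..b} t"
  have [measurable]: "f \<in> borel_measurable borel"
    using f by (intro borel_measurable_continuous_onI continuous_at_imp_continuous_on) auto
  have "(SUP n. ?f n t) = ennreal (f t) * indicator {..b} t" for t
  proof (rule antisym)
    show "(SUP n. ?f n t) \<le> ennreal (f t) * indicator {..b} t"
      by (intro SUP_least) (auto split: split_indicator)
    obtain n where "b - t \<le> real n"
      using real_arch_simple by blast
    then have "ennreal (f t) * indicator {..b} t = ?f n t"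
      by (auto split: split_indicator)
    then show "ennreal (f t) * indicator {..b} t \<le> (SUP n. ?f n t)"
      using SUP_upper[of n UNIV "\<lambda>n. ?f n t"] by simp
  qed
  then have "(\<integral>\<^sup>+ t. ennreal (f t) * indicator {..b} t \<partial>lborel) = (\<integral>\<^sup>+ t. (SUP n. ?f n t) \<partial>lborel)"
    by simp
  also have "\<dots> = (SUP n. \<integral>\<^sup>+ t. ?f n t \<partial>lborel)"
    by (intro nn_integral_monotone_convergence_SUP)
      (auto simp: incseq_def le_fun_def split: split_indicator)
  also have "\<dots> \<le> ennreal (B - F b)"
  proof (rule SUP_least)
    fix n
    have "((\<lambda>t. - F t) has_real_derivative f t) (at t)" for t
      using DERIV_minus[OF F] by simp
    then have "(\<integral>\<^sup>+ t. ?f n t \<partial>lborel) = ennreal (- F b - - F (b - real n))"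
      using nonneg by (intro nn_integral_FTC_Icc[where F = "\<lambda>t. - F t"]) auto
    also have "\<dots> \<le> ennreal (B - F b)"
      using bound[of "b - real n"] by (intro ennreal_leI) simp
    finally show "(\<integral>\<^sup>+ t. ?f n t \<partial>lborel) \<le> ennreal (B - F b)" .
  qed
  finally show ?thesis .
qed

text \<open>
  Only the behaviour near \<open>-\<infinity>\<close> decides about divergence, so the upper limit may be moved freely.
\<close>
lemma nn_integral_lower_ray_extend:
  fixes f :: "real \<Rightarrow> real"
  assumes f: "\<And>t. isCont f t" and finite: "(\<integral>\<^sup>+ t. ennreal (f t) * indicator {..b} t \<partial>lborel) < \<infinity>"
  shows "(\<integral>\<^sup>+ t. ennreal (f t) \<partial>lebesgue_on {..v}) < \<infinity>"
proof -
  have [measurable]: "f \<in> borel_measurable borel"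
    using f by (intro borel_measurable_continuous_onI continuous_at_imp_continuous_on) auto
  have "continuous_on {b..v} f"
    using f by (intro continuous_at_imp_continuous_on) auto
  then obtain M where M: "\<And>t. t \<in> {b..v} \<Longrightarrow> f t \<le> M"
    using compact_continuous_image[OF _ compact_Icc] compact_imp_bounded bounded_imp_bdd_above
    unfolding bdd_above_def by (metis imageI)
  have "(\<integral>\<^sup>+ t. ennreal (f t) \<partial>lebesgue_on {..v}) = (\<integral>\<^sup>+ t. ennreal (f t) * indicator {..v} t \<partial>lborel)"
    by (simp add: nn_integral_restrict_space nn_integral_completion)
  also have "\<dots> \<le> (\<integral>\<^sup>+ t. ennreal (f t) * indicator {..b} t + ennreal M * indicator {b..v} t \<partial>lborel)"
    using M by (intro nn_integral_mono) (auto split: split_indicator intro: ennreal_leI)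
  also have "\<dots> = (\<integral>\<^sup>+ t. ennreal (f t) * indicator {..b} t \<partial>lborel) + ennreal M * emeasure lborel {b..v}"
    by (subst nn_integral_add) (auto simp: nn_integral_cmult_indicator)
  also have "\<dots> < \<infinity>"
    using finite by (auto simp: ennreal_mult_less_top emeasure_lborel_Icc_eq)
  finally show ?thesis .
qed

context decaying_strip
begin

lemma clock_exp: "t \<le> v \<Longrightarrow> clock v (exp (L t - L v)) = t"
  using L_less[of t v] by (cases "t = v") (auto simp: clock_def)

text \<open>
  Integration by parts in \<open>r\<close>: the function \<open>H r = r * f (clock v r) - N (clock v r)\<close> is a primitive
  of \<open>f (clock v r)\<close>. As \<open>f\<close> decreases near \<open>-\<infinity>\<close>, its value at time \<open>r\<close> is at most its mean
  over \<open>[r/2, r]\<close>, so the boundary term \<open>r * f (clock v r)\<close> is at most twice the whole integral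
  \<open>K\<close>. Then \<open>N\<close> is bounded as well.
\<close>
lemma weighted_primitive_bounded:
  assumes f: "\<And>t. (f has_real_derivative f' t) (at t)"
    and N: "\<And>t. (N has_real_derivative f' t * exp (L t - L v)) (at t)"
    and t1: "t1 \<le> v" "\<And>t. t \<le> t1 \<Longrightarrow> f' t \<le> 0"
    and nonneg: "\<And>t. t \<le> v \<Longrightarrow> 0 \<le> f t"
    and int: "(\<lambda>r. f (clock v r)) integrable_on {0..1}"
  obtains B where "\<And>t. t \<le> t1 \<Longrightarrow> N t \<le> B"
proof -
  define K where "K = integral {0..1} (\<lambda>r. f (clock v r))"
  define H where "H = (\<lambda>r. r * f (clock v r) - N (clock v r))"
  have deriv_H: "(H has_real_derivative f (clock v r)) (at r)" if "0 < r" "r < 1" for r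
  proof -
    let ?c = "inverse (rate (clock v r)) / r"
    have "((\<lambda>r. f (clock v r)) has_real_derivative f' (clock v r) * ?c) (at r)"
      and "((\<lambda>r. N (clock v r)) has_real_derivative f' (clock v r) * exp (L (clock v r) - L v) * ?c) (at r)"
      by (rule DERIV_chain2[OF f deriv_clock[OF that]], rule DERIV_chain2[OF N deriv_clock[OF that]])
    from DERIV_diff[OF DERIV_mult[OF DERIV_ident this(1)] this(2)]
    have "(H has_real_derivative (1 * f (clock v r) + f' (clock v r) * ?c * r) -
        f' (clock v r) * exp (L (clock v r) - L v) * ?c) (at r)"
      unfolding H_def .
    moreover have "exp (L (clock v r) - L v) = r"
      using that by (simp add: L_clock)
    ultimately show ?thesis by simp
  qed
  have isCont_H: "isCont H r" if "0 < r" for r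
  proof -
    have "isCont (\<lambda>r. f (clock v r)) r" "isCont (\<lambda>r. N (clock v r)) r"
      by (rule isCont_o2[OF continuous_clock[OF that] DERIV_isCont[OF f]],
          rule isCont_o2[OF continuous_clock[OF that] DERIV_isCont[OF N]])
    then show ?thesis
      unfolding H_def by (intro continuous_intros)
  qed
  have part_le: "integral {c..d} (\<lambda>r. f (clock v r)) \<le> K"
    and part_int: "(\<lambda>r. f (clock v r)) integrable_on {c..d}" if "0 \<le> c" "d \<le> 1" for c d
  proof -
    show int': "(\<lambda>r. f (clock v r)) integrable_on {c..d}"
      by (rule integrable_on_subinterval[OF int]) (use that in auto)
    show "integral {c..d} (\<lambda>r. f (clock v r)) \<le> K"
      unfolding K_def using int' int that nonneg clock_le' by (intro integral_subset_le) auto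
  qed
  have "N t \<le> 3 * K - H 1" if "t \<le> t1" for t
  proof -
    define r where "r = exp (L t - L v)"
    have clock_r: "clock v r = t"
      using that t1 clock_exp unfolding r_def by simp
    have r: "0 < r" "r \<le> 1"
      using L_less_iff[of v t] that t1 by (auto simp: r_def)
    have "((\<lambda>r. f (clock v r)) has_integral H 1 - H r) {r..1}"
      using r deriv_H isCont_H
      by (intro fundamental_theorem_of_calculus_interior continuous_at_imp_continuous_on)
        (auto simp flip: has_real_derivative_iff_has_vector_derivative)
    then have 1: "H 1 - H r \<le> K"
      using part_le[of r 1] r by (simp add: integral_unique)
    have "r / 2 * f t = integral {r/2..r} (\<lambda>_. f t)"
      using r by simp
    also have "\<dots> \<le> integral {r/2..r} (\<lambda>r. f (clock v r))"
    proof (rule integral_le[OF integrable_const_ivl part_int])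
      fix q assume q: "q \<in> {r/2..r}"
      then have "clock v q \<le> t"
        using clock_mono[of q r v] r clock_r by auto
      then show "f t \<le> f (clock v q)"
      proof (rule DERIV_nonpos_imp_nonincreasing)
        show "\<exists>y. DERIV f u :> y \<and> y \<le> 0" if "u \<le> t" for u
          using f[of u] t1(2)[of u] that \<open>t \<le> t1\<close> by auto
      qed
    qed (use r in auto)
    also have "\<dots> \<le> K"
      using part_le r by simp
    finally have "r * f t \<le> 2 * K" by simp
    then show ?thesis
      using 1 by (simp add: H_def clock_r)
  qed
  then show thesis using that by blast
qed

text \<open>
  The constant \<open>c\<close> converts the weight normalised at \<open>v\<close> into the one normalised at \<open>v0\<close>.
\<close>
lemma weighted_primitive_unbounded:
  assumes cont: "\<And>t. isCont f' t"
    and N: "\<And>t. (N has_real_derivative f' t * exp (L t - L v)) (at t)"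
    and neg: "\<And>t. t \<le> t1 \<Longrightarrow> f' t \<le> 0"
    and inf: "(\<integral>\<^sup>+ t. ennreal (- (f' t * exp (L t - L v0))) \<partial>lebesgue_on {..v0}) = \<infinity>"
  shows "\<exists>t\<le>t1. B < N t"
proof (rule ccontr)
  assume "\<not> (\<exists>t\<le>t1. B < N t)"
  then have bound: "\<And>t. t \<le> t1 \<Longrightarrow> N t \<le> B" by force
  define c where "c = exp (L v - L v0)"
  define f where "f = (\<lambda>t. - (f' t * exp (L t - L v0)))"
  have cont_f: "isCont f t" for t
    unfolding f_def using cont DERIV_isCont[OF deriv_L] by (intro continuous_intros)
  have "((\<lambda>t. c * N t) has_real_derivative - f t) (at t)" for t
  proof -
    have "c * (f' t * exp (L t - L v)) = - f t"
      by (simp add: c_def f_def exp_diff)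
    then show ?thesis
      using DERIV_cmult[OF N[of t], of c] by simp
  qed
  moreover have "0 \<le> f t" if "t \<le> t1" for t
    using neg[OF that] by (simp add: f_def mult_nonpos_nonneg)
  moreover have "c * N t \<le> c * B" if "t \<le> t1" for t
    using bound[OF that] by (simp add: c_def)
  ultimately have "(\<integral>\<^sup>+ t. ennreal (f t) * indicator {..t1} t \<partial>lborel) \<le> ennreal (c * B - c * N t1)"
    using cont_f by (intro nn_integral_lower_ray_bounded) auto
  also have "\<dots> < \<infinity>" by simp
  finally have "(\<integral>\<^sup>+ t. ennreal (f t) \<partial>lebesgue_on {..v0}) < \<infinity>"
    using nn_integral_lower_ray_extend[OF cont_f] by blast
  then show False
    using inf by (simp add: f_def)
qed

text \<open>
  The integrand is bounded below, so only its positive part can diverge. If that were finite, the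
  integrand would be integrable, and adding a constant to \<open>f\<close> to make it nonnegative would bound
  \<open>N\<close>.
\<close>
lemma ext_integral_infinite:
  fixes a b p v :: real
  assumes f: "\<And>t. (f has_real_derivative f' t) (at t)"
    and N: "\<And>t. (N has_real_derivative f' t * exp (L t - L v)) (at t)"
    and t1: "t1 \<le> v" "\<And>t. t \<le> t1 \<Longrightarrow> f' t \<le> 0"
    and unbounded: "\<And>B. \<exists>t\<le>t1. B < N t"
    and I: "a < b" "{a<..<b} \<subseteq> I" "I \<subseteq> {a..b}" and p: "0 < p" "a + p \<le> b"
  defines "F \<equiv> (\<lambda>u. f (clock v ((u - a) / p)))"
  shows "has_ext_integral I F" "ext_integral I F = \<infinity>"
proof -
  note I_facts = between_open_and_closed[OF I]
  have I_sets: "I \<in> sets lebesgue" by (rule I_facts)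
  have cont_f: "isCont f t" for t
    using f DERIV_isCont by blast
  obtain C where C: "0 \<le> C" "\<And>t. t \<le> v \<Longrightarrow> 0 \<le> f t + C"
  proof -
    have "compact (f ` {t1..v})"
      using cont_f by (intro compact_continuous_image continuous_at_imp_continuous_on) auto
    then obtain m where m: "\<And>t. t1 \<le> t \<Longrightarrow> t \<le> v \<Longrightarrow> m \<le> f t"
      using bounded_imp_bdd_below[OF compact_imp_bounded] unfolding bdd_below_def
      by (metis atLeastAtMost_iff imageI)
    have "m \<le> f t" if "t \<le> v" for t
    proof (cases "t1 \<le> t")
      case False
      then have "t \<le> t1" by simp
      then have "f t1 \<le> f t"
      proof (rule DERIV_nonpos_imp_nonincreasing)
        show "\<exists>y. DERIV f u :> y \<and> y \<le> 0" if "u \<le> t1" for u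
          using f[of u] t1(2)[OF that] by auto
      qed
      then show ?thesis using m[of t1] t1 by simp
    qed (use m that in auto)
    then show thesis
      using that[of "\<bar>m\<bar>"] by force
  qed
  have F_lower: "0 \<le> F u + C" if "u \<in> I" for u
  proof -
    have "0 \<le> (u - a) / p" using that I p by auto
    then show ?thesis
      unfolding F_def using C(2) clock_le' by simp
  qed
  have meas: "F \<in> borel_measurable (lebesgue_on I)"
  proof -
    have "continuous_on {a<..} F"
    proof (intro continuous_at_imp_continuous_on ballI)
      fix u assume "u \<in> {a<..}"
      then have "0 < (u - a) / p" using p by simp
      then have "isCont (clock v) ((u - a) / p)"
        by (rule continuous_clock)
      moreover have "isCont (\<lambda>u. (u - a) / p) u"
        using p by (intro continuous_intros) auto
      ultimately have "isCont (\<lambda>u. clock v ((u - a) / p)) u"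
        using isCont_o2[where f = "\<lambda>u. (u - a) / p"] by blast
      then show "isCont F u"
        unfolding F_def by (rule isCont_o2[OF _ cont_f])
    qed
    then have "(\<lambda>u. indicator {a<..} u *\<^sub>R F u) \<in> borel_measurable borel"
      by (intro borel_measurable_continuous_on_indicator) auto
    \<comment> \<open>The clock is not continuous at time \<open>0\<close>, so the left end point is treated apart.\<close>
    then have "(\<lambda>u. indicator {a<..} u *\<^sub>R F u + indicator {a} u * F a) \<in> borel_measurable borel"
      by measurable
    then have "(\<lambda>u. indicator {a<..} u *\<^sub>R F u + indicator {a} u * F a) \<in> borel_measurable lebesgue"
      by (intro measurable_completion) simp
    then have "(\<lambda>u. indicator {a<..} u *\<^sub>R F u + indicator {a} u * F a) \<in> borel_measurable (lebesgue_on I)"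
      by (rule measurable_restrict_space1)
    moreover have "indicator {a<..} u *\<^sub>R F u + indicator {a} u * F a = F u" if "u \<in> space (lebesgue_on I)" for u
      using that I by (auto simp: space_restrict_space split: split_indicator)
    ultimately show ?thesis
      by (rule measurable_cong[THEN iffD1, rotated])
  qed
  have neg: "(\<integral>\<^sup>+ u. ennreal (- F u) \<partial>lebesgue_on I) < \<infinity>"
  proof -
    have "(\<integral>\<^sup>+ u. ennreal (- F u) \<partial>lebesgue_on I) \<le> (\<integral>\<^sup>+ u. ennreal C \<partial>lebesgue_on I)"
    proof (intro nn_integral_mono ennreal_leI)
      fix u assume "u \<in> space (lebesgue_on I)"
      then show "- F u \<le> C"
        using F_lower[of u] by (simp add: space_restrict_space)
    qed
    also have "\<dots> = ennreal C * emeasure lebesgue I"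
      using I_sets by (simp add: emeasure_restrict_space)
    also have "\<dots> < \<infinity>"
      using I_facts by (simp add: ennreal_mult_less_top)
    finally show ?thesis .
  qed
  have pos: "(\<integral>\<^sup>+ u. ennreal (F u) \<partial>lebesgue_on I) = \<infinity>"
  proof (rule ccontr)
    assume "(\<integral>\<^sup>+ u. ennreal (F u) \<partial>lebesgue_on I) \<noteq> \<infinity>"
    then have "integrable (lebesgue_on I) F"
      using meas neg by (auto simp: real_integrable_def)
    then have "F integrable_on {a..b}"
      using has_integral_integral_lebesgue_on[OF _ I_sets] I_facts(4) by blast
    then have "F integrable_on {a..a + p}"
      by (rule integrable_on_subinterval) (use p in auto)
    then obtain y where "(F has_integral y) {a..a + p}" by blast
    moreover have "{(0 - - (a / p)) / (1 / p)..(1 - - (a / p)) / (1 / p)} = {a..a + p}"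
      using p by (simp add: field_simps)
    ultimately have "((\<lambda>r. F ((r - - (a / p)) / (1 / p))) has_integral (1 / p) *\<^sub>R y) {0..1}"
      using p by (intro rescale_has_integral) auto
    moreover have "F ((r - - (a / p)) / (1 / p)) = f (clock v r)" for r
      unfolding F_def using p by (simp add: field_simps)
    ultimately have "(\<lambda>r. f (clock v r) + C) integrable_on {0..1}"
      by (auto intro!: integrable_add)
    moreover have "((\<lambda>t. f t + C) has_real_derivative f' t) (at t)" for t
      using f by (auto intro!: derivative_eq_intros)
    ultimately obtain B where "\<And>t. t \<le> t1 \<Longrightarrow> N t \<le> B"
      using weighted_primitive_bounded[of "\<lambda>t. f t + C" f' N v t1] N t1 C by blast
    then show False
      using unbounded[of B] by force
  qed
  show "has_ext_integral I F"
    using meas neg by (simp add: has_ext_integral_def)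
  show "ext_integral I F = \<infinity>"
    unfolding ext_integral_def pos using neg
    by (cases "\<integral>\<^sup>+ u. ennreal (- F u) \<partial>lebesgue_on I") auto
qed

end

section \<open>The curves of the family\<close>

context curve_family
begin

lemma zero_index: "0 \<in> index_set \<epsilon>max"
  using eps_max_pos by (simp add: index_set_def zero_ereal_def)

lemma convex_curve_member:
  assumes e: "e \<in> index_set \<epsilon>max"
  obtains c' c'' where "convex_curve (\<lambda>t. G t e) c' c''"
proof -
  obtain D :: "nat \<Rightarrow> nat \<Rightarrow> curves" where D0: "\<And>t. D 0 0 t e = G t e"
    and D: "\<And>i t. i < 3 \<Longrightarrow> ((\<lambda>\<tau>. D i 0 \<tau> e) has_vector_derivative D (Suc i) 0 t e) (at t)"
    using smooth e unfolding C31_on_def by (metis zero_le)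
  define c' where "c' = (\<lambda>t. D 1 0 t e)"
  define c'' where "c'' = (\<lambda>t. D 2 0 t e)"
  have d: "((\<lambda>t. G t e) has_vector_derivative c' t) (at t)" "(c' has_vector_derivative c'' t) (at t)" for t
    using D[of 0 t] D[of 1 t] by (simp_all add: D0 c'_def c''_def numeral_2_eq_2)
  have "isCont c'' t" for t
    using D[of 2 t] has_vector_derivative_continuous unfolding c''_def by auto
  then have cont: "continuous_on UNIV c''"
    by (simp add: continuous_at_imp_continuous_on)
  have components: "((\<lambda>t. fst (c t)) has_real_derivative fst (c' t)) (at t)"
      "((\<lambda>t. snd (c t)) has_real_derivative snd (c' t)) (at t)"
    if "\<And>t. (c has_vector_derivative c' t) (at t)" for t and c c' :: "real \<Rightarrow> real \<times> real"
    using has_derivative_fst[OF that[of t, unfolded has_vector_derivative_def]]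
      has_derivative_snd[OF that[of t, unfolded has_vector_derivative_def]]
    by (simp_all add: has_field_derivative_def mult_commute_abs)
  have eqs: "deriv (\<lambda>t. fst (G t e)) = (\<lambda>t. fst (c' t))" "deriv (\<lambda>t. snd (G t e)) = (\<lambda>t. snd (c' t))"
    "deriv (\<lambda>t. fst (c' t)) = (\<lambda>t. fst (c'' t))" "deriv (\<lambda>t. snd (c' t)) = (\<lambda>t. snd (c'' t))"
    using components[OF d(1)] components[OF d(2)] by (auto intro!: ext DERIV_imp_deriv)
  have "convex_curve (\<lambda>t. G t e) c' c''"
    using d cont fst_deriv_pos[OF e] curvature_pos[OF e] by unfold_locales (auto simp: eqs)
  then show thesis by (rule that)
qed

text \<open>
  Nestedness puts \<open>\<Xi>\<^sub>\<epsilon>\<close> weakly above the fixed boundary. A point of the curve of index \<open>\<epsilon>\<close>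
  lies in the closure of \<open>\<Xi>\<^sub>\<epsilon>\<close>, so separation makes the inequality strict.
\<close>
lemma strip_member:
  assumes \<epsilon>: "\<epsilon> \<in> index_set \<epsilon>max" "0 < \<epsilon>"
    and g: "convex_curve (\<lambda>t. G t 0) g' g''" and h: "convex_curve (\<lambda>t. G t \<epsilon>) h' h''"
  shows "strip (\<lambda>t. G t 0) g' g'' (\<lambda>t. G t \<epsilon>) h' h''"
proof -
  interpret g: convex_curve "\<lambda>t. G t 0" g' g'' by fact
  interpret h: convex_curve "\<lambda>t. G t \<epsilon>" h' h'' by fact
  have line: "tangent_line G \<epsilon> s = {p. h.tangent_height s (fst p) = snd p}" for s
    unfolding tangent_line_def by (rule h.tangent_line_eq)
  have params: "tangency_params G \<epsilon> t = {s. h.tangent_height s (fst (G t 0)) = snd (G t 0)}" for t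
    by (simp add: tangency_params_def line)
  show ?thesis
  proof unfold_locales
    fix s
    have above: "(fst (G s \<epsilon>), y) \<in> Xi G \<epsilon>" if "snd (G s \<epsilon>) < y" for y
      using that by (auto simp: Xi_def)
    then have "(fst (G s \<epsilon>), y) \<in> Xi G 0" if "snd (G s \<epsilon>) < y" for y
      using nested[OF zero_index \<epsilon>] that by blast
    then have above': "\<exists>t. fst (G t 0) = fst (G s \<epsilon>) \<and> snd (G t 0) < y" if "snd (G s \<epsilon>) < y" for y
      using that by (fastforce simp: Xi_def)
    then obtain t where t: "fst (G t 0) = fst (G s \<epsilon>)"
      using gt_ex by blast
    have "snd (G t 0) < y" if "snd (G s \<epsilon>) < y" for y
    proof -
      obtain t' where t': "fst (G t' 0) = fst (G s \<epsilon>)" "snd (G t' 0) < y"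
        using above'[OF \<open>snd (G s \<epsilon>) < y\<close>] by blast
      then have "t' = t"
        using t g.fst_eq_iff[of t' t] by simp
      then show ?thesis using t' by simp
    qed
    then have "snd (G t 0) \<le> snd (G s \<epsilon>)"
      by (rule dense_ge[OF less_imp_le])
    moreover have "G s \<epsilon> \<in> closure (Xi G \<epsilon>)"
      unfolding closure_approachable
    proof (intro allI impI)
      fix e :: real assume "0 < e"
      then have "dist (fst (G s \<epsilon>), snd (G s \<epsilon>) + e / 2) (G s \<epsilon>) < e"
        by (simp add: dist_prod_def dist_real_def)
      then show "\<exists>y\<in>Xi G \<epsilon>. dist y (G s \<epsilon>) < e"
        using above[of "snd (G s \<epsilon>) + e / 2"] \<open>0 < e\<close> by auto
    qed
    then have "G t 0 \<noteq> G s \<epsilon>"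
      using separated[OF zero_index \<epsilon>, of t] by (cases "G t 0 = G s \<epsilon>") (simp_all only: simp_thms)
    then have "snd (G t 0) \<noteq> snd (G s \<epsilon>)"
      using t by (simp add: prod_eq_iff)
    ultimately show "\<exists>t. fst (G t 0) = fst (G s \<epsilon>) \<and> snd (G t 0) < snd (G s \<epsilon>)"
      using t by force
  next
    fix t
    show "card {s. h.tangent_height s (fst (G t 0)) = snd (G t 0)} = 2"
      using two_tangents[OF \<epsilon>] by (simp add: params)
  next
    fix s t assume st: "h.tangent_height s (fst (G t 0)) = snd (G t 0)"
    then have "card (tangent_line G \<epsilon> s \<inter> range (\<lambda>\<tau>. G \<tau> 0)) = 2"
      by (intro tangents_meet_twice[OF \<epsilon>, of _ t]) (simp add: params)
    then obtain p q where pq: "tangent_line G \<epsilon> s \<inter> range (\<lambda>\<tau>. G \<tau> 0) = {p, q}" "p \<noteq> q"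
      by (auto simp: card_2_iff)
    define q' where "q' = (if p = G t 0 then q else p)"
    have "q' \<in> tangent_line G \<epsilon> s \<inter> range (\<lambda>\<tau>. G \<tau> 0)" "q' \<noteq> G t 0"
      unfolding pq(1) q'_def using pq(2) by auto
    then obtain t' where "q' = G t' 0" "G t' 0 \<in> tangent_line G \<epsilon> s" "G t' 0 \<noteq> G t 0"
      by blast
    then show "\<exists>t'. t' \<noteq> t \<and> h.tangent_height s (fst (G t' 0)) = snd (G t' 0)"
      unfolding line by (intro exI[of _ t']) auto
  qed
qed

end

section \<open>Sign of the derivative of the boundary function\<close>

text \<open>
  A nondecreasing function that is nonpositive somewhere is nonpositive to the left of that
  place; otherwise it is positive everywhere.
\<close>
lemma monotone_sign_at_bot:
  fixes h :: "real \<Rightarrow> real"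
  assumes "monotone_on {..<a} (\<le>) (\<le>) h \<or> monotone_on {..<a} (\<le>) (\<ge>) h"
  obtains b where "b < a" "\<forall>t\<le>b. h t \<le> 0" | b where "b < a" "\<forall>t\<le>b. 0 \<le> h t"
proof -
  have mono: "(\<exists>b<a. \<forall>t\<le>b. k t \<le> 0) \<or> (\<exists>b<a. \<forall>t\<le>b. 0 \<le> k t)"
    if "monotone_on {..<a} (\<le>) (\<le>) k" for k :: "real \<Rightarrow> real"
  proof (cases "\<exists>b<a. k b \<le> 0")
    case True
    then obtain b where b: "b < a" "k b \<le> 0" by blast
    then have "k t \<le> 0" if "t \<le> b" for t
      using monotone_onD[OF \<open>monotone_on _ _ _ k\<close>, of t b] that by simp
    then show ?thesis using b by blast
  next
    case False
    have "0 \<le> k t" if "t \<le> a - 1" for t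
    proof -
      have "t < a" using that by simp
      then show ?thesis using False by force
    qed
    then show ?thesis by (intro disjI2 exI[of _ "a - 1"]) auto
  qed
  have "monotone_on {..<a} (\<le>) (\<le>) (\<lambda>t. - h t)" if "monotone_on {..<a} (\<le>) (\<ge>) h"
    using that unfolding monotone_on_def by simp
  then show thesis
    using assms mono[of h] mono[of "\<lambda>t. - h t"] that by auto
qed

text \<open>
  A function monotone near \<open>-\<infinity>\<close> has a constant sign there. This applies first to the torsion,
  which has the sign of \<open>\<kappa>\<^sub>3'\<close> because \<open>\<kappa>\<^sub>2' > 0\<close>; so \<open>\<kappa>\<^sub>3\<close> is monotone near \<open>-\<infinity>\<close>, and
  it applies again to \<open>\<kappa>\<^sub>3\<close>, which has the sign of \<open>f'\<close>.
\<close>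
lemma (in curve_family) deriv_sign_at_bot:
  assumes "regular G f"
  obtains b where "\<forall>t\<le>b. deriv f t \<le> 0" | b where "\<forall>t\<le>b. 0 \<le> deriv f t"
proof -
  obtain g' g'' where "convex_curve (\<lambda>t. G t 0) g' g''"
    using convex_curve_member[OF zero_index] .
  then interpret g: convex_curve "\<lambda>t. G t 0" g' g'' .
  have "\<exists>d. (kappa3 G f has_real_derivative d) (at t)" for t
  proof -
    have "deriv f differentiable at t"
      using assms by (simp add: regular_def C2_def)
    then have "(deriv f has_real_derivative deriv (deriv f) t) (at t)"
      by (simp add: DERIV_deriv_iff_real_differentiable)
    then show ?thesis
      unfolding kappa3_def[abs_def] g.deriv_eqs
      using DERIV_divide[OF _ g.deriv_fst' g.fst_c'_neq_0] by blast
  qed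
  then have D3: "(kappa3 G f has_real_derivative deriv (kappa3 G f) t) (at t)" for t
    by (metis DERIV_imp_deriv)
  have "kappa2 G = g.grad"
    by (auto simp: kappa2_def g.deriv_eqs g.grad_def)
  then have "deriv (kappa2 G) t = g.grad' t" for t
    using DERIV_imp_deriv[OF g.deriv_grad] by simp
  then have kappa2_pos: "0 < deriv (kappa2 G) t" for t
    using g.grad'_pos by simp
  obtain P where P: "finite P" "\<And>J. is_interval J \<Longrightarrow> J \<inter> P = {} \<Longrightarrow>
      monotone_on J (\<le>) (\<le>) (torsion G f) \<or> monotone_on J (\<le>) (\<ge>) (torsion G f)"
    using assms unfolding regular_def finitely_piecewise_monotone_def by blast
  \<comment> \<open>The element \<open>0\<close> serves the case of no break point.\<close>
  define a where "a = Min (insert 0 P)"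
  have "{..<a} \<inter> P = {}"
  proof (intro equals0I)
    fix t assume "t \<in> {..<a} \<inter> P"
    then have "t < a" "a \<le> t"
      using P(1) by (auto simp: a_def intro: Min_le)
    then show False by simp
  qed
  then have "monotone_on {..<a} (\<le>) (\<le>) (torsion G f) \<or> monotone_on {..<a} (\<le>) (\<ge>) (torsion G f)"
    by (intro P(2)) (auto simp: is_interval_1)
  then have "\<exists>b. monotone_on {..<b} (\<le>) (\<le>) (kappa3 G f) \<or> monotone_on {..<b} (\<le>) (\<ge>) (kappa3 G f)"
  proof (cases rule: monotone_sign_at_bot)
    case (1 b)
    have sign: "deriv (kappa3 G f) t \<le> 0" if "t \<le> b" for t
    proof -
      have "torsion G f t \<le> 0"
        using 1 that by blast
      then show ?thesis
        using kappa2_pos[of t] by (auto simp: torsion_def divide_le_0_iff)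
    qed
    have "monotone_on {..<b} (\<le>) (\<ge>) (kappa3 G f)"
    proof (rule monotone_onI)
      fix x y assume xy: "x \<in> {..<b}" "y \<in> {..<b}" "x \<le> y"
      show "kappa3 G f y \<le> kappa3 G f x"
        by (rule DERIV_nonpos_imp_nonincreasing[OF xy(3)]) (use D3 sign xy in force)
    qed
    then show ?thesis by blast
  next
    case (2 b)
    have sign: "0 \<le> deriv (kappa3 G f) t" if "t \<le> b" for t
    proof -
      have "0 \<le> torsion G f t"
        using 2 that by blast
      then show ?thesis
        using kappa2_pos[of t] by (auto simp: torsion_def zero_le_divide_iff)
    qed
    have "monotone_on {..<b} (\<le>) (\<le>) (kappa3 G f)"
    proof (rule monotone_onI)
      fix x y assume xy: "x \<in> {..<b}" "y \<in> {..<b}" "x \<le> y"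
      show "kappa3 G f x \<le> kappa3 G f y"
        by (rule DERIV_nonneg_imp_nondecreasing[OF xy(3)]) (use D3 sign xy in force)
    qed
    then show ?thesis by blast
  qed
  then obtain b where "monotone_on {..<b} (\<le>) (\<le>) (kappa3 G f) \<or> monotone_on {..<b} (\<le>) (\<ge>) (kappa3 G f)"
    by blast
  moreover have deriv_f: "deriv f t = kappa3 G f t * fst (g' t)" for t
    by (simp add: kappa3_def g.deriv_eqs)
  ultimately show thesis
  proof (cases rule: monotone_sign_at_bot)
    case (1 b)
    then show thesis
      using that(1)[of b] g.fst_c'_pos by (simp add: deriv_f mult_le_0_iff less_imp_le)
  next
    case (2 b)
    then show thesis
      using that(2)[of b] g.fst_c'_pos by (simp add: deriv_f less_imp_le)
  qed
qed

section \<open>The Bellman function\<close>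

lemma negative_part_infinite:
  assumes "\<not> - \<infinity> < ext_integral S h"
  shows "(\<integral>\<^sup>+ t. ennreal (- h t) \<partial>lebesgue_on S) = \<infinity>" (is "?neg = _")
proof (rule ccontr)
  assume "?neg \<noteq> \<infinity>"
  then have "- \<infinity> < enn2ereal p - enn2ereal ?neg" for p
    by (cases ?neg; cases p) auto
  then show False
    using assms by (simp add: ext_integral_def)
qed

theorem proposition5p2p6:
  fixes \<epsilon>max :: ereal and G :: curves and \<epsilon> :: real and f :: "real \<Rightarrow> real"
    and I :: "real set" and x :: "real \<times> real"
  assumes "curve_family \<epsilon>max G"
    and "0 < \<epsilon>" and "ereal \<epsilon> < \<epsilon>max"
    and "regular G f"
    and "\<forall>t0. ((\<lambda>t. (1 + norm (w_R G \<epsilon> t - G t 0)) * exp (- integral {t..t0} (lambda_R G \<epsilon>)))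
           \<longlongrightarrow> 0) at_bot"
    and "\<not> (\<forall>v. ext_integral {..v} (\<lambda>\<tau>. deriv f \<tau> * exp (- integral {\<tau>..v} (lambda_R G \<epsilon>))) > -\<infinity>)"
    and "bounded_interval I"
    and "x \<in> Omega G \<epsilon> - fixed_boundary G"
  shows "bellman G \<epsilon> I f x = \<infinity>"
proof -
  interpret curve_family \<epsilon>max G by fact
  have \<epsilon>: "\<epsilon> \<in> index_set \<epsilon>max"
    using assms(2,3) by (simp add: index_set_def)
  obtain g' g'' where g: "convex_curve (\<lambda>t. G t 0) g' g''"
    using convex_curve_member[OF zero_index] .
  obtain h' h'' where h: "convex_curve (\<lambda>t. G t \<epsilon>) h' h''"
    using convex_curve_member[OF \<epsilon>] .
  interpret strip "\<lambda>t. G t 0" g' g'' "\<lambda>t. G t \<epsilon>" h' h''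
    by (rule strip_member[OF \<epsilon> assms(2) g h])

  have params: "tangency_params G \<epsilon> t = tangencies t" for t
    unfolding tangency_params_def tangent_line_def upper.tangent_line_eq tangencies_def by simp
  have w_R: "w_R G \<epsilon> = contact"
    by (simp add: w_R_def contact_def params right_param_def fun_eq_iff)
  have lambda: "lambda_R G \<epsilon> t = rate t" for t
    unfolding lambda_R_def w_R vector_derivative_at[OF deriv_contact]
    using rate_unique[of _ t] by blast
  have Omega: "Omega G \<epsilon> = region"
    unfolding Omega_def region_eq_triangles curv_triangle_def
    by (simp add: Xi_def w_R_def w_L_def params right_param_def left_param_def prod_eq_iff)

  obtain L where L: "\<And>t. (L has_real_derivative rate t) (at t)"
    using einterval_antiderivative[of "-\<infinity>" \<infinity> rate] continuous_rate
    by (auto simp: has_real_derivative_iff_has_vector_derivative)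
  have integral_rate: "integral {t..t0} (lambda_R G \<epsilon>) = L t0 - L t" if "t \<le> t0" for t t0
  proof -
    have "(rate has_integral L t0 - L t) {t..t0}"
      using L[unfolded has_real_derivative_iff_has_vector_derivative] that
      by (blast intro: fundamental_theorem_of_calculus has_vector_derivative_at_within)
    then show ?thesis
      by (simp add: lambda[abs_def] integral_unique cong: integral_cong)
  qed
  have "((\<lambda>t. exp (L 0) * ((1 + norm (w_R G \<epsilon> t - G t 0)) * exp (- integral {t..0} (lambda_R G \<epsilon>))))
      \<longlongrightarrow> exp (L 0) * 0) at_bot"
    by (intro tendsto_mult_left assms(5)[rule_format])
  moreover have "\<forall>\<^sub>F t in at_bot. exp (L 0) * ((1 + norm (w_R G \<epsilon> t - G t 0)) *
      exp (- integral {t..0} (lambda_R G \<epsilon>))) = (1 + norm (contact t - G t 0)) * exp (L t)"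
    using eventually_le_at_bot[of 0]
    by eventually_elim (simp add: integral_rate w_R exp_diff)
  ultimately have decay: "((\<lambda>t. (1 + norm (contact t - G t 0)) * exp (L t)) \<longlongrightarrow> 0) at_bot"
    by (auto elim: Lim_transform_eventually)
  interpret decaying_strip "\<lambda>t. G t 0" g' g'' "\<lambda>t. G t \<epsilon>" h' h'' L
    by unfold_locales (fact L decay)+

  obtain v \<alpha> where \<alpha>: "0 < \<alpha>" "\<alpha> \<le> 1" and x: "x = \<alpha> *\<^sub>R contact v + (1 - \<alpha>) *\<^sub>R G v 0"
  proof -
    have "x \<in> region" "x \<notin> range (\<lambda>t. G t 0)"
      using assms(8) by (auto simp: Omega fixed_boundary_def)
    then show thesis
      using right_tangent_through_point[of x] that unfolding contact_def by blast
  qed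
  obtain a b where I: "a < b" "{a<..<b} \<subseteq> I" "I \<subseteq> {a..b}"
    using bounded_interval_endpoints[OF assms(7)] .
  \<comment> \<open>Time \<open>1\<close>, where the constant stretch begins, is placed at the fraction \<open>\<alpha>\<close> of \<open>I\<close>.\<close>
  define p where "p = \<alpha> * (b - a)"
  have p: "0 < p" "p \<le> b - a" and p_\<alpha>: "p / (b - a) = \<alpha>"
    using \<alpha> I(1) by (auto simp: p_def mult_le_cancel_right1)
  define \<phi> where "\<phi> = (\<lambda>u. trajectory v ((u - a) / p))"

  have "\<phi> \<in> test_class G \<epsilon> I"
    using rescaled_trajectory_integrable[OF I p(1)] average_rescaled_trajectory_in_region[OF I p(1)] trajectory_on_curve
    unfolding test_class_def \<phi>_def fixed_boundary_def Omega by blast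
  moreover have "average I \<phi> = x"
    unfolding \<phi>_def average_rescaled_trajectory_total[OF I p] p_\<alpha> x ..
  moreover have "boundary_fun G f \<circ> \<phi> = (\<lambda>u. f (clock v ((u - a) / p)))"
  proof -
    have "inj (\<lambda>t. G t 0)"
      by (rule injI, drule arg_cong[of _ _ fst]) simp
    then show ?thesis
      by (simp add: fun_eq_iff boundary_fun_def \<phi>_def trajectory_def the_inv_f_f[of "\<lambda>t. G t 0"])
  qed
  moreover have "has_ext_integral I (\<lambda>u. f (clock v ((u - a) / p))) \<and>
      ext_integral I (\<lambda>u. f (clock v ((u - a) / p))) = \<infinity>"
  proof -
    have C2: "(f has_real_derivative deriv f t) (at t)" "isCont (deriv f) t" for t
      using assms(4) by (auto simp: regular_def C2_def DERIV_deriv_iff_real_differentiable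
          intro: differentiable_imp_continuous_within)
    obtain N where N: "\<And>t. (N has_real_derivative deriv f t * exp (L t - L v)) (at t)"
      using einterval_antiderivative[of "-\<infinity>" \<infinity> "\<lambda>t. deriv f t * exp (L t - L v)"] C2(2) DERIV_isCont[OF L]
      by (auto simp: has_real_derivative_iff_has_vector_derivative)
    obtain v0 where v0: "\<not> - \<infinity> < ext_integral {..v0} (\<lambda>\<tau>. deriv f \<tau> * exp (- integral {\<tau>..v0} (lambda_R G \<epsilon>)))"
      using assms(6) by blast
    define w where "w = (\<lambda>t. - (deriv f t * exp (L t - L v0)))"
    have cont_w: "isCont w t" for t
      unfolding w_def using C2(2) DERIV_isCont[OF L] by (intro continuous_intros)
    have inf: "(\<integral>\<^sup>+ t. ennreal (w t) \<partial>lebesgue_on {..v0}) = \<infinity>"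
    proof -
      have "(\<integral>\<^sup>+ t. ennreal (- (deriv f t * exp (- integral {t..v0} (lambda_R G \<epsilon>)))) \<partial>lebesgue_on {..v0}) = \<infinity>"
        using v0 by (rule negative_part_infinite)
      also have "(\<integral>\<^sup>+ t. ennreal (- (deriv f t * exp (- integral {t..v0} (lambda_R G \<epsilon>)))) \<partial>lebesgue_on {..v0})
          = (\<integral>\<^sup>+ t. ennreal (w t) \<partial>lebesgue_on {..v0})"
        by (intro nn_integral_cong) (auto simp: w_def space_restrict_space integral_rate)
      finally show ?thesis .
    qed
    \<comment> \<open>If \<open>f'\<close> were nonnegative near \<open>-\<infinity>\<close>, the negative part would have a finite integral.\<close>
    obtain t1 where t1: "\<forall>t\<le>t1. deriv f t \<le> 0"
    proof (rule deriv_sign_at_bot[OF assms(4)])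
      fix t1 assume "\<forall>t\<le>t1. 0 \<le> deriv f t"
      then have zero: "ennreal (w t) * indicator {..t1} t = 0" for t
        by (auto simp: w_def ennreal_neg split: split_indicator)
      have "(\<integral>\<^sup>+ t. ennreal (w t) * indicator {..t1} t \<partial>lborel) = (\<integral>\<^sup>+ (t::real). 0 \<partial>lborel)"
        by (rule nn_integral_cong) (rule zero)
      then have "(\<integral>\<^sup>+ t. ennreal (w t) \<partial>lebesgue_on {..v0}) < \<infinity>"
        by (intro nn_integral_lower_ray_extend[OF cont_w, of t1]) simp
      then show thesis using inf by simp
    qed
    have "\<exists>t\<le>min t1 v. B < N t" for B
      by (rule weighted_primitive_unbounded[OF C2(2) N]) (use t1 inf in \<open>auto simp: w_def\<close>)
    then show ?thesis
      using ext_integral_infinite[OF C2(1) N _ _ _ I p(1), of "min t1 v"] t1 p(2) by auto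
  qed
  moreover have "ext_average I (\<lambda>u. f (clock v ((u - a) / p))) = \<infinity>"
    if "ext_integral I (\<lambda>u. f (clock v ((u - a) / p))) = \<infinity>"
    using that I(1) by (simp add: ext_average_def between_open_and_closed[OF I])
  ultimately have "\<infinity> \<in> {ext_average I (boundary_fun G f \<circ> \<phi>) | \<phi>.
      \<phi> \<in> test_class G \<epsilon> I \<and> average I \<phi> = x \<and> has_ext_integral I (boundary_fun G f \<circ> \<phi>)}"
    by (intro CollectI exI[of _ \<phi>]) simp
  then have "\<infinity> \<le> bellman G \<epsilon> I f x"
    unfolding bellman_def by (rule Sup_upper)
  then show ?thesis by simp
qed

end
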